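(* Let $T:\mathcal{Z}_0^{(0,1)}\to\mathcal{Z}_0^{(0,1)}$ be a map. Then $T$ is a surjective linear isometry if and only if there exist a disc automorphism $\sigma$ of $\triangle$ and a real number $\alpha$ such that for every $f\in\mathcal{Z}_0^{(0,1)}$ and every $z\in\triangle$, $$Tf(z)=e^{i\alpha}\int_0^z\left[(f'\circ\sigma)(\xi)-(f'\circ\sigma)(0)\right]d\xi .$$
   Context: $\triangle=\{z\in\mathbb{C}:|z|<1\}$ is the open unit disc. The Zygmund space $\mathcal{Z}$ is the set of all analytic functions $f:\triangle\to\mathbb{C}$ that extend continuously to the boundary of $\triangle$ and satisfy $\sup_{|z|<1}(1-|z|^2)|f''(z)|<\infty$, with norm $\|f\|_{\mathcal{Z}}=|f(0)|+|f'(0)|+\sup_{|z|<1}(1-|z|^2)|f''(z)|$. The little Zygmund space is $\mathcal{Z}_0=\{f\in\mathcal{Z}:\lim_{|z|\to1^-}(1-|z|^2)|f''(z)|=0\}$, and $\mathcal{Z}_0^{(0,1)}=\{f\in\mathcal{Z}_0: f(0)=f'(0)=0\}$, with the norm inherited from $\mathcal{Z}$ (so $\|f\|=\sup_{|z|<1}(1-|z|^2)|f''(z)|$ there). A disc automorphism is a bijective analytic map $\triangle\to\triangle$. The integral is the complex line integral along any path in $\triangle$ from $0$ to $z$. *)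

theory Defs
  imports "HOL-Complex_Analysis.Complex_Analysis"
begin

abbreviation unit_disc :: "complex set" where
  "unit_disc \<equiv> ball 0 1"

text \<open>
  A function from the unit disc to the complex numbers is represented by the total function that
  agrees with it on the disc and is 0 elsewhere. Thus equality of total functions in the spaces
  below is equality on the disc, and pointwise sums and multiples stay within the representation.
  Derivatives are only ever taken at points of the (open) disc, so they do not depend on the
  values outside.
\<close>

definition zygmund_seminorm :: "(complex \<Rightarrow> complex) \<Rightarrow> real" where
  "zygmund_seminorm f = (SUP z\<in>unit_disc. (1 - (norm z)\<^sup>2) * norm (deriv (deriv f) z))"

definition zygmund_norm :: "(complex \<Rightarrow> complex) \<Rightarrow> real" where
  "zygmund_norm f = norm (f 0) + norm (deriv f 0) + zygmund_seminorm f"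

definition zygmund_space :: "(complex \<Rightarrow> complex) set" where
  "zygmund_space = {f. (\<forall>z. z \<notin> unit_disc \<longrightarrow> f z = 0)
     \<and> f analytic_on unit_disc
     \<and> (\<exists>g. continuous_on (closure unit_disc) g \<and> (\<forall>z\<in>unit_disc. g z = f z))
     \<and> bdd_above ((\<lambda>z. (1 - (norm z)\<^sup>2) * norm (deriv (deriv f) z)) ` unit_disc)}"

text \<open>The filter \<open>filtercomap norm (at_left 1)\<close> expresses that \<open>norm z\<close> tends to 1 from below.\<close>

definition little_zygmund_space :: "(complex \<Rightarrow> complex) set" where
  "little_zygmund_space = {f \<in> zygmund_space.
     ((\<lambda>z. (1 - (norm z)\<^sup>2) * norm (deriv (deriv f) z)) \<longlongrightarrow> 0) (filtercomap norm (at_left 1))}"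

definition little_zygmund_space_01 :: "(complex \<Rightarrow> complex) set" where
  "little_zygmund_space_01 = {f \<in> little_zygmund_space. f 0 = 0 \<and> deriv f 0 = 0}"

definition disc_automorphism :: "(complex \<Rightarrow> complex) \<Rightarrow> bool" where
  "disc_automorphism \<sigma> \<longleftrightarrow> \<sigma> analytic_on unit_disc \<and> bij_betw \<sigma> unit_disc unit_disc"

definition complex_linear_on ::
    "(complex \<Rightarrow> complex) set \<Rightarrow> ((complex \<Rightarrow> complex) \<Rightarrow> (complex \<Rightarrow> complex)) \<Rightarrow> bool" where
  "complex_linear_on V T \<longleftrightarrow>
     (\<forall>f\<in>V. \<forall>g\<in>V. T (\<lambda>z. f z + g z) = (\<lambda>z. T f z + T g z)) \<and>
     (\<forall>c. \<forall>f\<in>V. T (\<lambda>z. c * f z) = (\<lambda>z. c * T f z))"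

definition zygmund_isometry_on ::
    "(complex \<Rightarrow> complex) set \<Rightarrow> ((complex \<Rightarrow> complex) \<Rightarrow> (complex \<Rightarrow> complex)) \<Rightarrow> bool" where
  "zygmund_isometry_on V T \<longleftrightarrow>
     (\<forall>f\<in>V. \<forall>g\<in>V. zygmund_norm (\<lambda>z. T f z - T g z) = zygmund_norm (\<lambda>z. f z - g z))"

end

theory Submission
  imports Defs
begin

text \<open>
  Via \<open>f \<mapsto> f''\<close> the space is isometric to the analytic \<open>h\<close> on the disc with
  \<open>(1 - |z|\<^sup>2) |h(z)| \<rightarrow> 0\<close> at the boundary, under the weighted sup norm; the continuous extension of
  \<open>f\<close> is automatic, since integrating twice along radii makes \<open>f\<close> uniformly continuous. On that space the norm is
  differentiable at the derivative \<open>h\<^sub>w\<close> of each disc automorphism vanishing at \<open>w\<close>, because the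
  weighted modulus of \<open>h\<^sub>w\<close> is one minus the squared modulus of that automorphism, and its only support
  functional there is the weighted evaluation at \<open>w\<close>. Hence the inverse of a surjective isometry \<open>T\<close>
  carries weighted evaluations to unimodular multiples of weighted evaluations, so that
  \<open>(Tf)'' = u \<cdot> (f'' \<circ> \<sigma>)\<close>; testing on \<open>f'' = 1\<close> and \<open>f'' = z\<close> shows that \<open>u\<close> and \<open>\<sigma>\<close> are
  analytic. Applied to \<open>T\<close> and its inverse this makes \<open>\<sigma>\<close> an automorphism. Equality in the
  Schwarz--Pick inequality then gives \<open>|u| = |\<sigma>'|\<close>, and the maximum principle makes \<open>u / \<sigma>'\<close> constant.
\<close>

subsection \<open>The weight and the continuous extension\<close>

definition disc_weight :: "complex \<Rightarrow> real" where
  "disc_weight z = 1 - (norm z)\<^sup>2"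

definition weight_vanishing :: "(complex \<Rightarrow> complex) \<Rightarrow> bool" where
  "weight_vanishing h \<longleftrightarrow>
     (\<forall>e>0. \<exists>r<1. \<forall>z\<in>unit_disc. r < norm z \<longrightarrow> disc_weight z * norm (h z) < e)"

lemma disc_weight_pos: "z \<in> unit_disc \<Longrightarrow> 0 < disc_weight z"
  by (simp add: disc_weight_def abs_square_less_1)

lemma disc_weight_le_1: "disc_weight z \<le> 1"
  by (simp add: disc_weight_def)

lemma continuous_on_disc_weight [continuous_intros]: "continuous_on S disc_weight"
  unfolding disc_weight_def by (intro continuous_intros)

text \<open>Estimates use the threshold form and limit rules use the filter form. The absolute value
  in the limit disappears because the weight is positive on the disc.\<close>

lemma weight_vanishing_iff_tendsto:
  "weight_vanishing h \<longleftrightarrow>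
     ((\<lambda>z. (1 - (norm z)\<^sup>2) * norm (h z)) \<longlongrightarrow> 0) (filtercomap norm (at_left 1))"
proof -
  have ev: "eventually P (filtercomap norm (at_left (1::real))) \<longleftrightarrow>
      (\<exists>r<1. \<forall>z\<in>unit_disc. r < norm z \<longrightarrow> P z)" for P :: "complex \<Rightarrow> bool"
  proof
    assume "eventually P (filtercomap norm (at_left (1::real)))"
    then obtain Q where Q: "eventually Q (at_left (1::real))" "\<And>z. Q (norm z) \<Longrightarrow> P z"
      by (auto simp: eventually_filtercomap)
    then show "\<exists>r<1. \<forall>z\<in>unit_disc. r < norm z \<longrightarrow> P z"
      by (auto simp: eventually_at_left_field)
  next
    assume "\<exists>r<1. \<forall>z\<in>unit_disc. r < norm z \<longrightarrow> P z"
    then obtain r :: real where "r < 1" "\<And>z. norm z < 1 \<Longrightarrow> r < norm z \<Longrightarrow> P z"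
      by auto
    then show "eventually P (filtercomap norm (at_left (1::real)))"
      unfolding eventually_filtercomap eventually_at_left_field
      by (intro exI[of _ "\<lambda>y. r < y \<and> y < 1"]) auto
  qed
  have "((\<lambda>z. (1 - (norm z)\<^sup>2) * norm (h z)) \<longlongrightarrow> 0) (filtercomap norm (at_left 1)) \<longleftrightarrow>
     (\<forall>e>0. \<exists>r<1. \<forall>z\<in>unit_disc. r < norm z \<longrightarrow> \<bar>disc_weight z * norm (h z)\<bar> < e)"
    by (simp add: tendsto_iff ev disc_weight_def)
  also have "\<dots> \<longleftrightarrow> weight_vanishing h"
    unfolding weight_vanishing_def
    using disc_weight_pos by (auto simp: abs_mult less_imp_le abs_of_pos)
  finally show ?thesis by simp
qed

text \<open>A compact subset of the disc has a point of largest modulus and so lies in a smaller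
  concentric disc. The compact form is the one that a homeomorphism of the disc preserves, as
  surjectivity requires later.\<close>

lemma weight_vanishing_iff_compact:
  "weight_vanishing h \<longleftrightarrow>
     (\<forall>e>0. \<exists>K. compact K \<and> K \<subseteq> unit_disc \<and> (\<forall>z\<in>unit_disc - K. disc_weight z * norm (h z) < e))"
proof
  assume h: "weight_vanishing h"
  show "\<forall>e>0. \<exists>K. compact K \<and> K \<subseteq> unit_disc \<and> (\<forall>z\<in>unit_disc - K. disc_weight z * norm (h z) < e)"
  proof (intro allI impI)
    fix e :: real assume "e > 0"
    then obtain r where "r < 1" "\<forall>z\<in>unit_disc. r < norm z \<longrightarrow> disc_weight z * norm (h z) < e"
      using h unfolding weight_vanishing_def by blast
    then show "\<exists>K. compact K \<and> K \<subseteq> unit_disc \<and> (\<forall>z\<in>unit_disc - K. disc_weight z * norm (h z) < e)"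
      by (intro exI[of _ "cball 0 r"]) auto
  qed
next
  assume h: "\<forall>e>0. \<exists>K. compact K \<and> K \<subseteq> unit_disc \<and> (\<forall>z\<in>unit_disc - K. disc_weight z * norm (h z) < e)"
  show "weight_vanishing h"
    unfolding weight_vanishing_def
  proof (intro allI impI)
    fix e :: real assume "e > 0"
    then obtain K where K: "compact K" "K \<subseteq> unit_disc" "\<forall>z\<in>unit_disc - K. disc_weight z * norm (h z) < e"
      using h by blast
    have "\<exists>r<1. \<forall>z\<in>K. norm z \<le> r"
    proof (cases "K = {}")
      case False
      then obtain x where "x \<in> K" "\<forall>z\<in>K. norm z \<le> norm x"
        using continuous_attains_sup[OF K(1), of norm] by (auto intro: continuous_intros)
      then show ?thesis using K(2) by (intro exI[of _ "norm x"]) auto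
    qed (auto intro: exI[of _ 0])
    then show "\<exists>r<1. \<forall>z\<in>unit_disc. r < norm z \<longrightarrow> disc_weight z * norm (h z) < e"
      using K(3) by (meson DiffI not_le)
  qed
qed

lemma weight_vanishing_add:
  assumes "weight_vanishing f" "weight_vanishing g"
  shows "weight_vanishing (\<lambda>z. f z + g z)"
proof -
  show ?thesis unfolding weight_vanishing_def
  proof (intro allI impI)
    fix e :: real assume "e > 0"
    then have "e/2 > 0" by simp
    obtain r where r: "r < 1" "\<And>z. z\<in>unit_disc \<Longrightarrow> r < norm z \<Longrightarrow> disc_weight z * norm (f z) < e/2"
      using assms(1) \<open>e/2 > 0\<close> unfolding weight_vanishing_def by blast
    obtain s where s: "s < 1" "\<And>z. z\<in>unit_disc \<Longrightarrow> s < norm z \<Longrightarrow> disc_weight z * norm (g z) < e/2"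
      using assms(2) \<open>e/2 > 0\<close> unfolding weight_vanishing_def by blast
    have "disc_weight z * norm (f z + g z) < e" if "z \<in> unit_disc" "max r s < norm z" for z
    proof -
      have "disc_weight z * norm (f z + g z) \<le> disc_weight z * (norm (f z) + norm (g z))"
        using disc_weight_pos[OF that(1)] by (intro mult_left_mono norm_triangle_ineq) auto
      then show ?thesis
        using r(2)[of z] s(2)[of z] that by (auto simp: distrib_left)
    qed
    then show "\<exists>r<1. \<forall>z\<in>unit_disc. r < norm z \<longrightarrow> disc_weight z * norm (f z + g z) < e"
      using r(1) s(1) by (intro exI[of _ "max r s"]) auto
  qed
qed

lemma weight_vanishing_cmult:
  assumes "weight_vanishing f"
  shows "weight_vanishing (\<lambda>z. c * f z)"
  using tendsto_mult_left[OF assms[unfolded weight_vanishing_iff_tendsto], of "norm c"]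
  unfolding weight_vanishing_iff_tendsto by (simp add: norm_mult mult_ac)

lemma weight_vanishing_cong:
  assumes "weight_vanishing f" "\<And>z. z \<in> unit_disc \<Longrightarrow> f z = g z"
  shows "weight_vanishing g"
  using assms unfolding weight_vanishing_def by (metis (no_types, lifting))

lemma bounded_imp_weight_vanishing:
  assumes "\<And>z. z \<in> unit_disc \<Longrightarrow> norm (h z) \<le> B"
  shows "weight_vanishing h"
  unfolding weight_vanishing_def
proof (intro allI impI)
  fix e :: real assume "e > 0"
  \<comment> \<open>For \<open>norm z > r\<close> the weight is at most
    \<open>2 * (1 - norm z) < e / (\<bar>B\<bar> + 1)\<close>; the added 1 keeps the denominator
    positive.\<close>
  define r where "r = 1 - e / (2 * (\<bar>B\<bar> + 1))"
  have "r < 1" using \<open>e > 0\<close> by (simp add: r_def)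
  have "disc_weight z * norm (h z) < e" if "z \<in> unit_disc" "r < norm z" for z
  proof -
    have "disc_weight z = (1 - norm z) * (1 + norm z)"
      by (simp add: disc_weight_def power2_eq_square algebra_simps)
    also have "\<dots> \<le> (1 - norm z) * 2"
      using that by (intro mult_left_mono) auto
    also have "\<dots> < e / (\<bar>B\<bar> + 1)"
      using that by (simp add: r_def field_simps)
    finally have "disc_weight z < e / (\<bar>B\<bar> + 1)" .
    moreover have "norm (h z) \<le> \<bar>B\<bar> + 1"
      using assms[OF that(1)] by linarith
    ultimately have "disc_weight z * norm (h z) \<le> disc_weight z * (\<bar>B\<bar> + 1)"
      using disc_weight_pos[OF that(1)] by (intro mult_left_mono) auto
    also have "\<dots> < e"
      using \<open>disc_weight z < _\<close> by (simp add: pos_less_divide_eq)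
    finally show ?thesis .
  qed
  then show "\<exists>r<1. \<forall>z\<in>unit_disc. r < norm z \<longrightarrow> disc_weight z * norm (h z) < e"
    using \<open>r < 1\<close> by blast
qed

lemma weight_vanishing_attains_sup:
  assumes "continuous_on unit_disc h" "weight_vanishing h"
  shows "\<exists>a\<in>unit_disc. \<forall>z\<in>unit_disc. disc_weight z * norm (h z) \<le> disc_weight a * norm (h a)"
proof (cases "\<exists>b\<in>unit_disc. h b \<noteq> 0")
  case True
  then obtain b where b: "b \<in> unit_disc" "h b \<noteq> 0" by blast
  \<comment> \<open>With its value at \<open>b\<close> as threshold, \<open>b\<close> must lie in
    the compact set \<open>K\<close>, so the maximum over \<open>K\<close> also dominates everything
    outside \<open>K\<close>.\<close>
  define e where "e = disc_weight b * norm (h b)"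
  have "e > 0" using b disc_weight_pos by (simp add: e_def)
  from assms(2)[unfolded weight_vanishing_iff_compact, THEN spec, THEN mp, OF this]
  obtain K where K: "compact K" "K \<subseteq> unit_disc" "\<And>z. z\<in>unit_disc - K \<Longrightarrow> disc_weight z * norm (h z) < e"
    by blast
  have "b \<in> K" using K(3)[of b] b by (auto simp: e_def)
  moreover have "continuous_on K (\<lambda>z. disc_weight z * norm (h z))"
    using assms(1) K(2) by (intro continuous_intros) (auto intro: continuous_on_subset)
  ultimately obtain a where a: "a \<in> K" "\<And>z. z \<in> K \<Longrightarrow> disc_weight z * norm (h z) \<le> disc_weight a * norm (h a)"
    using continuous_attains_sup[OF K(1)] by (metis (no_types, lifting) empty_iff)
  then have "e \<le> disc_weight a * norm (h a)" using \<open>b \<in> K\<close> by (auto simp: e_def)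
  then have "disc_weight z * norm (h z) \<le> disc_weight a * norm (h a)" if "z \<in> unit_disc" for z
    using a(2)[of z] K(3)[of z] that by (cases "z \<in> K") auto
  then show ?thesis using a(1) K(2) by blast
qed (intro bexI[of _ 0]; simp)

section \<open>Radial growth estimates and uniform continuity\<close>

text \<open>Mean value inequality along the radius, with a real majorant \<open>\<phi>\<close>.
  Derivatives are compared only strictly between \<open>r\<close> and 1, so \<open>\<phi>'\<close>
  may blow up at 1 as long as \<open>\<phi>\<close> stays continuous there.\<close>

lemma radial_increment_bound:
  fixes F :: "complex \<Rightarrow> complex"
  assumes "F holomorphic_on unit_disc" "z \<in> unit_disc" "0 \<le> r" "r < 1"
    and "continuous_on {r..1} \<phi>"
    and "\<And>t. r < t \<Longrightarrow> t < 1 \<Longrightarrow> (\<phi> has_real_derivative \<phi>' t) (at t)"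
    and "\<And>t. r < t \<Longrightarrow> t < 1 \<Longrightarrow> norm z * norm (deriv F (of_real t * z)) \<le> \<phi>' t"
  shows "norm (F z - F (of_real r * z)) \<le> \<phi> 1 - \<phi> r"
proof -
  have inD: "of_real t * z \<in> unit_disc" if "r \<le> t" "t \<le> 1" for t :: real
    using that assms(2,3) mult_left_le_one_le[of "norm z" t] by (auto simp: norm_mult)
  have "norm (F (of_real 1 * z) - F (of_real r * z)) \<le> \<phi> 1 - \<phi> r"
  proof (rule differentiable_bound_general[where f = "\<lambda>t. F (of_real t * z)"
          and f' = "\<lambda>t. z * deriv F (of_real t * z)" and \<phi>' = \<phi>'])
    show "continuous_on {r..1} (\<lambda>t. F (of_real t * z))"
      using inD by (intro continuous_on_compose2[OF holomorphic_on_imp_continuous_on[OF assms(1)]] continuous_intros) auto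
    fix t :: real assume t: "r < t" "t < 1"
    have "(F has_field_derivative deriv F (of_real t * z)) (at (of_real t * z))"
      using inD[of t] t assms(1) by (auto intro: holomorphic_derivI[OF _ open_ball])
    moreover have "((\<lambda>t. of_real t * z) has_vector_derivative z) (at t)"
      by (auto intro!: derivative_eq_intros simp: has_vector_derivative_def scaleR_conv_of_real)
    ultimately show "((\<lambda>t. F (of_real t * z)) has_vector_derivative z * deriv F (of_real t * z)) (at t)"
      using field_vector_diff_chain_at[of "\<lambda>t. of_real t * z" z t F] by (simp add: o_def)
  qed (use assms in \<open>auto simp: norm_mult has_real_derivative_iff_has_vector_derivative\<close>)
  then show ?thesis by simp
qed

text \<open>The weight is at least \<open>1 - norm y\<close>, so the derivative is at most
  \<open>M / (1 - norm y)\<close>. Integration would give a logarithm; the cruder inverse square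
  root has an elementary form and is still integrable up to the circle.\<close>

lemma growth_of_primitive:
  assumes p: "p holomorphic_on unit_disc"
    and M: "\<And>z. z \<in> unit_disc \<Longrightarrow> disc_weight z * norm (deriv p z) \<le> M"
    and z: "z \<in> unit_disc"
  shows "norm (p z) \<le> (norm (p 0) + 2 * M) / sqrt (1 - norm z)"
proof -
  define a where "a = norm z"
  have a: "0 \<le> a" "a < 1" using z by (auto simp: a_def)
  have "0 \<le> M"
    using M[of 0] norm_ge_zero[of "deriv p 0"] by (simp add: disc_weight_def del: norm_ge_zero)
  \<comment> \<open>The derivative is \<open>M * a\<close> over the power 3/2 of
    \<open>1 - t * a\<close>, which exceeds \<open>M * a / (1 - t * a)\<close> because
    \<open>1 - t * a\<close> is at most 1.\<close>
  define \<phi> where "\<phi> = (\<lambda>t. 2 * M / sqrt (1 - t * a))"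
  have pos: "0 < 1 - t * a" if "t \<le> 1" for t
    using a mult_right_mono[OF that a(1)] by linarith
  have "norm (p z - p (of_real 0 * z)) \<le> \<phi> 1 - \<phi> 0"
  proof (rule radial_increment_bound[OF p z, where \<phi>' = "\<lambda>t. M * a / ((1 - t * a) * sqrt (1 - t * a))"])
    show "continuous_on {0..1} \<phi>" unfolding \<phi>_def
      using pos by (intro continuous_intros) (auto simp: less_le)
    fix t :: real assume t: "0 < t" "t < 1"
    have q: "0 < 1 - t * a" using pos t by auto
    show "(\<phi> has_real_derivative M * a / ((1 - t * a) * sqrt (1 - t * a))) (at t)"
      unfolding \<phi>_def using q
      by (auto intro!: derivative_eq_intros simp: field_simps)
    define y where "y = of_real t * z"
    have ny: "norm y = t * a" using t by (simp add: y_def a_def norm_mult)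
    have "y \<in> unit_disc" using q ny by simp
    have "disc_weight y = (1 - t * a) * (1 + t * a)"
      by (simp add: disc_weight_def ny power2_eq_square algebra_simps)
    then have "1 - t * a \<le> disc_weight y"
      using q t a mult_left_mono[of 1 "1 + t * a" "1 - t * a"] by simp
    then have "(1 - t * a) * norm (deriv p y) \<le> M"
      using M[OF \<open>y \<in> unit_disc\<close>] by (meson mult_right_mono norm_ge_zero order_trans)
    then have "norm (deriv p y) \<le> M / (1 - t * a)"
      using q by (simp add: field_simps)
    also have "\<dots> \<le> M / ((1 - t * a) * sqrt (1 - t * a))"
      using q \<open>0 \<le> M\<close> t a by (intro divide_left_mono) (auto intro!: mult_left_le)
    finally show "norm z * norm (deriv p (of_real t * z)) \<le> M * a / ((1 - t * a) * sqrt (1 - t * a))"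
      using a by (metis a_def mult.commute mult_left_mono times_divide_eq_right y_def)
  qed auto
  then have "norm (p z - p 0) \<le> 2 * M / sqrt (1 - norm z)"
    using \<open>0 \<le> M\<close> by (simp add: \<phi>_def a_def)
  moreover have "norm (p 0) \<le> norm (p 0) / sqrt (1 - norm z)"
    using a by (simp add: le_divide_eq mult_left_le a_def[symmetric])
  ultimately show ?thesis
    using norm_triangle_sub[of "p z" "p 0"] by (simp add: add_divide_distrib)
qed

text \<open>The growth bound applied to \<open>deriv f\<close> gives
  \<open>C / sqrt (1 - t)\<close>, whose integral from \<open>r\<close> to 1 is
  \<open>2 * C * sqrt (1 - r)\<close>, uniformly in \<open>z\<close>.\<close>

lemma zygmund_radial_modulus:
  assumes f: "f holomorphic_on unit_disc"
    and M: "\<And>z. z \<in> unit_disc \<Longrightarrow> disc_weight z * norm (deriv (deriv f) z) \<le> M"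
    and "z \<in> unit_disc" "0 \<le> r" "r < 1"
  shows "norm (f z - f (of_real r * z)) \<le> 2 * (norm (deriv f 0) + 2 * M) * sqrt (1 - r)"
proof -
  define C where "C = norm (deriv f 0) + 2 * M"
  have "0 \<le> M"
    using M[of 0] norm_ge_zero[of "deriv (deriv f) 0"] by (simp add: disc_weight_def del: norm_ge_zero)
  then have "0 \<le> C" by (simp add: C_def)
  have "norm (f z - f (of_real r * z)) \<le> - 2 * C * sqrt (1 - 1) - (- 2 * C * sqrt (1 - r))"
  proof (rule radial_increment_bound[OF f assms(3-5), where \<phi> = "\<lambda>t. - 2 * C * sqrt (1 - t)"
        and \<phi>' = "\<lambda>t. C / sqrt (1 - t)"])
    fix t :: real assume t: "r < t" "t < 1"
    show "((\<lambda>t. - 2 * C * sqrt (1 - t)) has_real_derivative C / sqrt (1 - t)) (at t)"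
      using t by (auto intro!: derivative_eq_intros simp: field_simps)
    define y where "y = of_real t * z"
    have ny: "norm y \<le> t" using t assms by (simp add: y_def norm_mult mult_left_le)
    then have "y \<in> unit_disc" using t by simp
    have "norm (deriv f y) \<le> C / sqrt (1 - norm y)"
      unfolding C_def using growth_of_primitive[OF holomorphic_deriv[OF f open_ball] M \<open>y \<in> unit_disc\<close>] .
    also have "\<dots> \<le> C / sqrt (1 - t)"
      using ny t \<open>0 \<le> C\<close> by (intro divide_left_mono) auto
    finally have "norm (deriv f y) \<le> C / sqrt (1 - t)" .
    moreover have "norm z * norm (deriv f y) \<le> norm (deriv f y)"
      using assms(3) by (simp add: mult_left_le_one_le)
    ultimately show "norm z * norm (deriv f (of_real t * z)) \<le> C / sqrt (1 - t)"
      by (simp add: y_def)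
  qed (intro continuous_intros)
  then show ?thesis by (simp add: C_def algebra_simps)
qed

text \<open>Three-epsilon argument: \<open>f\<close> is uniformly close to its dilation by
  \<open>r\<close> near 1, and the dilation only sees \<open>f\<close> on a compact disc.\<close>

lemma zygmund_uniformly_continuous:
  assumes f: "f holomorphic_on unit_disc"
    and M: "\<And>z. z \<in> unit_disc \<Longrightarrow> disc_weight z * norm (deriv (deriv f) z) \<le> M"
  shows "uniformly_continuous_on unit_disc f"
  unfolding uniformly_continuous_on_def
proof (intro allI impI)
  fix e :: real assume "e > 0"
  define C where "C = 2 * (norm (deriv f 0) + 2 * M)"
  have "((\<lambda>r. C * sqrt (1 - r)) \<longlongrightarrow> C * sqrt (1 - 1)) (at_left 1)"
    by (intro tendsto_intros)
  then have "\<forall>\<^sub>F r in at_left 1. C * sqrt (1 - r) < e / 3"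
    using \<open>e > 0\<close> by (intro order_tendstoD(2)[where y = "C * sqrt (1 - 1)"]) auto
  moreover have "\<forall>\<^sub>F r in at_left 1. r \<in> {0::real<..<1}"
    by (intro eventually_at_leftI[of 0]) auto
  ultimately have "\<forall>\<^sub>F r in at_left 1. C * sqrt (1 - r) < e / 3 \<and> 0 < r \<and> r < 1"
    by eventually_elim auto
  then obtain r where r: "C * sqrt (1 - r) < e / 3" "0 < r" "r < 1"
    using eventually_happens[of _ "at_left (1::real)"] by auto
  have "uniformly_continuous_on (cball 0 r) f"
    using r by (intro compact_uniformly_continuous continuous_on_subset[OF holomorphic_on_imp_continuous_on[OF f]]) auto
  then obtain d where d: "d > 0" "\<And>x y. x \<in> cball 0 r \<Longrightarrow> y \<in> cball 0 r \<Longrightarrow> dist y x < d \<Longrightarrow> dist (f y) (f x) < e / 3"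
    using \<open>e > 0\<close> unfolding uniformly_continuous_on_def by (metis zero_less_divide_iff zero_less_numeral)
  have "dist (f y) (f x) < e" if xy: "x \<in> unit_disc" "y \<in> unit_disc" "dist y x < d" for x y
  proof -
    have "dist (of_real r * y) (of_real r * x) = r * dist y x"
      using r by (simp add: dist_norm norm_mult flip: right_diff_distrib)
    also have "\<dots> \<le> dist y x" using r by (intro mult_left_le_one_le) auto
    finally have "dist (of_real r * y) (of_real r * x) < d" using xy by linarith
    then have "dist (f (of_real r * y)) (f (of_real r * x)) < e / 3"
      using xy r by (intro d(2)) (auto simp: norm_mult mult_left_le)
    moreover have "dist (f y) (f (of_real r * y)) < e / 3" "dist (f x) (f (of_real r * x)) < e / 3"
      using zygmund_radial_modulus[OF f M, of _ r] xy r
      unfolding dist_norm C_def by (meson less_eq_real_def order_le_less_trans)+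
    ultimately show ?thesis
      using dist_triangle3[of "f y" "f (of_real r * x)" "f (of_real r * y)"]
        dist_triangle2[of "f y" "f x" "f (of_real r * x)"] by (simp add: dist_commute)
  qed
  then show "\<exists>d>0. \<forall>x\<in>unit_disc. \<forall>x'\<in>unit_disc. dist x' x < d \<longrightarrow> dist (f x') (f x) < e"
    using d(1) by blast
qed

section \<open>The space described by second derivatives\<close>

text \<open>From right to left, the decay makes the weighted supremum attained, hence finite; the
  resulting uniform continuity extends \<open>f\<close> to the closed disc.\<close>

lemma little_zygmund_01_iff:
  "f \<in> little_zygmund_space_01 \<longleftrightarrow>
     (\<forall>z. z \<notin> unit_disc \<longrightarrow> f z = 0) \<and> f holomorphic_on unit_disc \<and>
     weight_vanishing (deriv (deriv f)) \<and> f 0 = 0 \<and> deriv f 0 = 0" (is "?L \<longleftrightarrow> ?R")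
proof
  assume ?L
  then show ?R
    unfolding little_zygmund_space_01_def little_zygmund_space_def zygmund_space_def
      weight_vanishing_iff_tendsto by (auto simp: analytic_on_open)
next
  assume R: ?R
  then have h: "deriv (deriv f) holomorphic_on unit_disc"
    by (intro holomorphic_deriv) auto
  then obtain a where a: "\<And>z. z \<in> unit_disc \<Longrightarrow>
      disc_weight z * norm (deriv (deriv f) z) \<le> disc_weight a * norm (deriv (deriv f) a)"
    using weight_vanishing_attains_sup[OF holomorphic_on_imp_continuous_on[OF h]] R by blast
  have "uniformly_continuous_on unit_disc f"
    by (rule zygmund_uniformly_continuous[OF _ a]) (use R in auto)
  then obtain g where g: "uniformly_continuous_on (closure unit_disc) g" "\<And>z. z \<in> unit_disc \<Longrightarrow> f z = g z"
    by (rule uniformly_continuous_on_extension_on_closure) (rule that)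
  have "\<exists>g. continuous_on (closure unit_disc) g \<and> (\<forall>z\<in>unit_disc. g z = f z)"
    using uniformly_continuous_imp_continuous[OF g(1)] g(2) by (intro exI[of _ g]) auto
  moreover have "bdd_above ((\<lambda>z. (1 - (norm z)\<^sup>2) * norm (deriv (deriv f) z)) ` unit_disc)"
    using a unfolding disc_weight_def by (meson bdd_above.I2)
  ultimately show ?L
    using R unfolding little_zygmund_space_01_def little_zygmund_space_def zygmund_space_def
      weight_vanishing_iff_tendsto by (auto simp: analytic_on_open)
qed

lemma has_vanishing_second_primitive:
  assumes h: "h holomorphic_on unit_disc" "weight_vanishing h"
  shows "\<exists>f\<in>little_zygmund_space_01. \<forall>z\<in>unit_disc. deriv (deriv f) z = h z"
proof -
  have prim: "\<exists>q. \<forall>z\<in>unit_disc. (q has_field_derivative p z) (at z)" if "p holomorphic_on unit_disc" for p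
    using holomorphic_convex_primitive'[OF convex_ball open_ball that] at_within_open[OF _ open_ball]
    by metis
  obtain p0 where p0: "\<And>z. z \<in> unit_disc \<Longrightarrow> (p0 has_field_derivative h z) (at z)"
    using prim[OF h(1)] by blast
  define p where "p = (\<lambda>z. p0 z - p0 0)"
  have p: "(p has_field_derivative h z) (at z)" if "z \<in> unit_disc" for z
    unfolding p_def using p0[OF that] by (auto intro!: derivative_eq_intros)
  then have "p holomorphic_on unit_disc"
    by (subst holomorphic_on_open) blast+
  then obtain f0 where f0: "\<And>z. z \<in> unit_disc \<Longrightarrow> (f0 has_field_derivative p z) (at z)"
    using prim by blast
  \<comment> \<open>Normalised at the origin and cut off to 0 outside, as the representation
    demands; derivatives at points of the open disc do not see the cut-off.\<close>
  define f where "f = (\<lambda>z. if z \<in> unit_disc then f0 z - f0 0 else 0)"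
  have f: "(f has_field_derivative p z) (at z)" if "z \<in> unit_disc" for z
  proof (rule has_field_derivative_transform_within_open[OF _ open_ball that])
    show "((\<lambda>z. f0 z - f0 0) has_field_derivative p z) (at z)"
      using f0[OF that] by (auto intro!: derivative_eq_intros)
  qed (auto simp: f_def)
  then have df: "deriv f z = p z" if "z \<in> unit_disc" for z
    using that by (blast intro: DERIV_imp_deriv)
  have ddf: "deriv (deriv f) z = h z" if "z \<in> unit_disc" for z
    using has_field_derivative_transform_within_open[OF p[OF that] open_ball that, of "deriv f"] df
    by (simp add: DERIV_imp_deriv)
  have "f \<in> little_zygmund_space_01"
    unfolding little_zygmund_01_iff
  proof (intro conjI allI impI)
    show "f holomorphic_on unit_disc"
      using f by (subst holomorphic_on_open) blast+
    show "weight_vanishing (deriv (deriv f))"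
      using weight_vanishing_cong[OF h(2)] ddf by simp
    show "deriv f 0 = 0"
      by (simp add: df p_def)
  qed (auto simp: f_def)
  then show ?thesis using ddf by blast
qed

subsection \<open>Kernels and point evaluations\<close>

lemma holomorphic_unit_disc_eqI:
  assumes "F holomorphic_on unit_disc" "G holomorphic_on unit_disc"
    and "\<And>z. z \<in> unit_disc \<Longrightarrow> deriv F z = deriv G z" "F 0 = G 0" "z \<in> unit_disc"
  shows "F z = G z"
proof -
  have "((\<lambda>x. F x - G x) has_field_derivative 0) (at x within unit_disc)" if "x \<in> unit_disc" for x
  proof -
    have "((\<lambda>x. F x - G x) has_field_derivative deriv F x - deriv G x) (at x)"
      using that assms(1,2) by (intro derivative_intros) (auto intro: holomorphic_derivI[OF _ open_ball])
    then show ?thesis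
      using assms(3)[OF that] by (simp add: has_field_derivative_at_within)
  qed
  then obtain c where c: "\<forall>x\<in>unit_disc. F x - G x = c"
    using has_field_derivative_zero_constant[OF convex_ball] by blast
  then show ?thesis using c[rule_format, of 0] c[rule_format, OF assms(5)] assms(4) by simp
qed

lemma little_zygmund_01_D:
  assumes "f \<in> little_zygmund_space_01"
  shows "z \<notin> unit_disc \<Longrightarrow> f z = 0" "f holomorphic_on unit_disc"
    "deriv f holomorphic_on unit_disc" "deriv (deriv f) holomorphic_on unit_disc"
    "weight_vanishing (deriv (deriv f))" "f 0 = 0" "deriv f 0 = 0"
  using assms unfolding little_zygmund_01_iff by (auto intro!: holomorphic_deriv)

text \<open>Two integrations from the origin, where both functions and their first derivatives
  vanish. Every later identity in the space is checked on second derivatives through this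
  rule.\<close>

lemma little_zygmund_01_eqI:
  assumes f: "f \<in> little_zygmund_space_01" and g: "g \<in> little_zygmund_space_01"
    and eq: "\<And>z. z \<in> unit_disc \<Longrightarrow> deriv (deriv f) z = deriv (deriv g) z"
  shows "f = g"
proof
  fix z
  show "f z = g z"
  proof (cases "z \<in> unit_disc")
    case True
    note fD = little_zygmund_01_D[OF f] and gD = little_zygmund_01_D[OF g]
    have "deriv f x = deriv g x" if "x \<in> unit_disc" for x
      using holomorphic_unit_disc_eqI[OF fD(3) gD(3) eq _ that] fD(7) gD(7) by simp
    then show ?thesis
      using holomorphic_unit_disc_eqI[OF fD(2) gD(2) _ _ True] fD(6) gD(6) by simp
  qed (use little_zygmund_01_D(1) f g in metis)
qed

lemma deriv2_lincomb:
  assumes "f holomorphic_on unit_disc" "g holomorphic_on unit_disc" "z \<in> unit_disc"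
  shows "deriv (\<lambda>z. f z + c * g z) z = deriv f z + c * deriv g z"
    and "deriv (deriv (\<lambda>z. f z + c * g z)) z = deriv (deriv f) z + c * deriv (deriv g) z"
proof -
  have lin: "deriv (\<lambda>z. p z + c * q z) z = deriv p z + c * deriv q z"
    if "p holomorphic_on unit_disc" "q holomorphic_on unit_disc" "z \<in> unit_disc" for p q z
    using that
    by (intro DERIV_imp_deriv DERIV_add DERIV_cmult) (auto intro: holomorphic_derivI[OF _ open_ball])
  show "deriv (\<lambda>z. f z + c * g z) z = deriv f z + c * deriv g z"
    by (rule lin[OF assms])
  have "deriv (deriv (\<lambda>z. f z + c * g z)) z = deriv (\<lambda>z. deriv f z + c * deriv g z) z"
  proof (rule deriv_cong_ev)
    show "\<forall>\<^sub>F x in nhds z. deriv (\<lambda>z. f z + c * g z) x = deriv f x + c * deriv g x"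
      using eventually_nhds_in_open[OF open_ball assms(3)] by eventually_elim (rule lin[OF assms(1,2)])
  qed simp
  also have "\<dots> = deriv (deriv f) z + c * deriv (deriv g) z"
    by (rule lin) (use assms in \<open>auto intro: holomorphic_deriv\<close>)
  finally show "deriv (deriv (\<lambda>z. f z + c * g z)) z = deriv (deriv f) z + c * deriv (deriv g) z" .
qed

lemma little_zygmund_01_lincomb:
  assumes f: "f \<in> little_zygmund_space_01" and g: "g \<in> little_zygmund_space_01"
  shows "(\<lambda>z. f z + c * g z) \<in> little_zygmund_space_01"
  unfolding little_zygmund_01_iff
proof (intro conjI allI impI)
  note fD = little_zygmund_01_D[OF f] and gD = little_zygmund_01_D[OF g]
  show "f z + c * g z = 0" if "z \<notin> unit_disc" for z
    using fD(1)[OF that] gD(1)[OF that] by simp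
  show "(\<lambda>z. f z + c * g z) holomorphic_on unit_disc"
    using fD(2) gD(2) by (intro holomorphic_intros)
  show "weight_vanishing (deriv (deriv (\<lambda>z. f z + c * g z)))"
    using deriv2_lincomb(2)[OF fD(2) gD(2)]
    by (intro weight_vanishing_cong[OF weight_vanishing_add[OF fD(5) weight_vanishing_cmult[OF gD(5), of c]]]) simp
  show "f 0 + c * g 0 = 0" "deriv (\<lambda>z. f z + c * g z) 0 = 0"
    using fD gD deriv2_lincomb(1)[OF fD(2) gD(2), of 0] by auto
qed

lemma zero_in_little_zygmund_01: "(\<lambda>z. 0) \<in> little_zygmund_space_01"
  unfolding little_zygmund_01_iff
  using bounded_imp_weight_vanishing[of "\<lambda>_. 0" 0] by simp

lemma little_zygmund_01_cmult:
  "g \<in> little_zygmund_space_01 \<Longrightarrow> (\<lambda>z. c * g z) \<in> little_zygmund_space_01"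
  using little_zygmund_01_lincomb[OF zero_in_little_zygmund_01, of g c] by simp

section \<open>The norm as an attained weighted supremum, and the kernels\<close>

lemma zygmund_norm_01:
  assumes f: "f \<in> little_zygmund_space_01"
  shows "z \<in> unit_disc \<Longrightarrow> disc_weight z * norm (deriv (deriv f) z) \<le> zygmund_norm f"
    and "\<exists>a\<in>unit_disc. disc_weight a * norm (deriv (deriv f) a) = zygmund_norm f"
    and "zygmund_norm f = (SUP z\<in>unit_disc. disc_weight z * norm (deriv (deriv f) z))"
proof -
  note fD = little_zygmund_01_D[OF f]
  show N: "zygmund_norm f = (SUP z\<in>unit_disc. disc_weight z * norm (deriv (deriv f) z))"
    using fD by (simp add: zygmund_norm_def zygmund_seminorm_def disc_weight_def)
  obtain a where a: "a \<in> unit_disc" "\<And>z. z \<in> unit_disc \<Longrightarrow>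
      disc_weight z * norm (deriv (deriv f) z) \<le> disc_weight a * norm (deriv (deriv f) a)"
    using weight_vanishing_attains_sup[OF holomorphic_on_imp_continuous_on[OF fD(4)] fD(5)] by blast
  have Na: "zygmund_norm f = disc_weight a * norm (deriv (deriv f) a)"
    unfolding N by (rule cSup_eq_maximum) (use a in auto)
  then show "\<exists>a\<in>unit_disc. disc_weight a * norm (deriv (deriv f) a) = zygmund_norm f"
    using a(1) by metis
  show "disc_weight z * norm (deriv (deriv f) z) \<le> zygmund_norm f" if "z \<in> unit_disc"
    using a(2)[OF that] Na by simp
qed

text \<open>
  The derivative of the disc automorphism \<open>z \<mapsto> (z - w) / (1 - cnj w * z)\<close>, whose weighted modulus
  is 1 at \<open>w\<close> and smaller than 1 elsewhere.
\<close>

definition disc_kernel :: "complex \<Rightarrow> complex \<Rightarrow> complex" where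
  "disc_kernel w z = of_real (disc_weight w) / (1 - cnj w * z)\<^sup>2"

lemma disc_denominator_ge:
  assumes "w \<in> unit_disc" "z \<in> unit_disc"
  shows "1 - norm w \<le> norm (1 - cnj w * z)" "0 < norm (1 - cnj w * z)"
proof -
  have "norm (cnj w * z) \<le> norm w" using assms by (simp add: norm_mult mult_left_le)
  then show le: "1 - norm w \<le> norm (1 - cnj w * z)"
    using norm_triangle_ineq2[of 1 "cnj w * z"] by simp
  show "0 < norm (1 - cnj w * z)"
    by (rule less_le_trans[OF _ le]) (use assms(1) in simp)
qed

text \<open>The classical identity behind the pseudo-hyperbolic distance, obtained by expanding in
  real and imaginary parts.\<close>

lemma disc_weight_mult:
  "disc_weight w * disc_weight z = (norm (1 - cnj w * z))\<^sup>2 - (norm (z - w))\<^sup>2"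
  by (simp only: disc_weight_def cmod_power2) (simp add: algebra_simps power2_eq_square)

text \<open>Dividing the preceding identity by the squared denominator shows that the deficit from 1
  is exactly the squared pseudo-hyperbolic distance to \<open>w\<close>.\<close>

lemma disc_kernel_norm:
  assumes "w \<in> unit_disc" "z \<in> unit_disc"
  shows "disc_weight z * norm (disc_kernel w z) = 1 - (norm (z - w) / norm (1 - cnj w * z))\<^sup>2"
proof -
  have "disc_weight z * norm (disc_kernel w z) = disc_weight w * disc_weight z / (norm (1 - cnj w * z))\<^sup>2"
    using disc_weight_pos[OF assms(1)] by (simp add: disc_kernel_def norm_divide norm_power)
  also have "\<dots> = 1 - (norm (z - w) / norm (1 - cnj w * z))\<^sup>2"
    using disc_denominator_ge(2)[OF assms] unfolding disc_weight_mult
    by (simp add: diff_divide_distrib power_divide)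
  finally show ?thesis .
qed

lemma disc_kernel_diag: "w \<in> unit_disc \<Longrightarrow> disc_kernel w w = 1 / of_real (disc_weight w)"
proof -
  assume "w \<in> unit_disc"
  have "1 - cnj w * w = of_real (disc_weight w)"
    by (simp add: disc_weight_def complex_norm_square mult.commute flip: of_real_power)
  then show ?thesis by (simp add: disc_kernel_def power2_eq_square)
qed

text \<open>The denominator stays at least \<open>1 - norm w\<close> in modulus, so the kernel is
  bounded and its weighted modulus decays at the circle.\<close>

lemma exists_disc_kernel:
  assumes w: "w \<in> unit_disc"
  shows "\<exists>e\<in>little_zygmund_space_01. \<forall>z\<in>unit_disc. deriv (deriv e) z = disc_kernel w z"
proof (rule has_vanishing_second_primitive)
  show "disc_kernel w holomorphic_on unit_disc"
    unfolding disc_kernel_def using disc_denominator_ge(2)[OF w]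
    by (intro holomorphic_intros) force+
  show "weight_vanishing (disc_kernel w)"
  proof (rule bounded_imp_weight_vanishing)
    fix z assume z: "z \<in> unit_disc"
    have "norm (disc_kernel w z) = disc_weight w / (norm (1 - cnj w * z))\<^sup>2"
      using disc_weight_pos[OF w] by (simp add: disc_kernel_def norm_divide norm_power)
    also have "\<dots> \<le> disc_weight w / (1 - norm w)\<^sup>2"
      using disc_weight_pos[OF w] w disc_denominator_ge[OF w z]
      by (intro divide_left_mono power_mono mult_pos_pos zero_less_power) auto
    finally show "norm (disc_kernel w z) \<le> disc_weight w / (1 - norm w)\<^sup>2" .
  qed
qed

section \<open>Differentiability of the norm at a kernel\<close>

text \<open>Near \<open>w\<close> the difference quotient bounds \<open>k\<close> by a multiple of
  \<open>norm (z - w)\<close>; at distance at least \<open>d\<close> the global bound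
  \<open>M\<close> does. The denominator is at most 2, which turns this into pseudo-hyperbolic
  distance.\<close>

lemma weighted_bound_of_zero:
  assumes w: "w \<in> unit_disc" and k: "k holomorphic_on unit_disc" "k w = 0"
    and M: "\<And>z. z \<in> unit_disc \<Longrightarrow> disc_weight z * norm (k z) \<le> M"
  shows "\<exists>C. \<forall>z\<in>unit_disc. disc_weight z * norm (k z) \<le> C * (norm (z - w) / norm (1 - cnj w * z))"
proof -
  have "(k has_field_derivative deriv k w) (at w)"
    using w k by (auto intro: holomorphic_derivI[OF _ open_ball])
  then have "((\<lambda>z. norm ((k z - k w) / (z - w))) \<longlongrightarrow> norm (deriv k w)) (at w)"
    unfolding has_field_derivative_iff by (rule tendsto_norm)
  then have "\<forall>\<^sub>F z in at w. norm ((k z - k w) / (z - w)) < norm (deriv k w) + 1"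
    by (rule order_tendstoD) simp
  then obtain d where d: "d > 0" "\<And>z. z \<noteq> w \<Longrightarrow> dist z w < d \<Longrightarrow> norm ((k z - k w) / (z - w)) < norm (deriv k w) + 1"
    unfolding eventually_at by auto
  \<comment> \<open>One constant for both regimes: the difference quotient near \<open>w\<close>,
    and \<open>M / d\<close> where \<open>norm (z - w)\<close> is at least \<open>d\<close>.\<close>
  define B where "B = max (norm (deriv k w) + 1) (M / d)"
  have B: "0 \<le> B" by (simp add: B_def le_max_iff_disj)
  have near: "disc_weight z * norm (k z) \<le> B * norm (z - w)" if z: "z \<in> unit_disc" for z
  proof (cases "dist z w < d")
    case True
    have "norm (k z) \<le> (norm (deriv k w) + 1) * norm (z - w)"
    proof (cases "z = w")
      case False
      then show ?thesis using d(2)[OF False True] k(2) by (simp add: norm_divide pos_divide_less_eq)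
    qed (use k in simp)
    also have "\<dots> \<le> B * norm (z - w)" by (intro mult_right_mono) (auto simp: B_def)
    finally have "norm (k z) \<le> B * norm (z - w)" .
    moreover have "disc_weight z * norm (k z) \<le> norm (k z)"
      using disc_weight_le_1[of z] disc_weight_pos[OF z] by (simp add: mult_left_le_one_le)
    ultimately show ?thesis by linarith
  next
    case False
    have "M \<ge> 0" using M[of 0] norm_ge_zero[of "k 0"] by (simp add: disc_weight_def del: norm_ge_zero)
    have "disc_weight z * norm (k z) \<le> M" by (rule M[OF z])
    also have "M \<le> M / d * norm (z - w)"
      using False d(1) \<open>M \<ge> 0\<close> mult_left_mono[of d "norm (z - w)" M] by (simp add: dist_norm field_simps)
    also have "\<dots> \<le> B * norm (z - w)" by (intro mult_right_mono) (auto simp: B_def)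
    finally show ?thesis .
  qed
  have "disc_weight z * norm (k z) \<le> 2 * B * (norm (z - w) / norm (1 - cnj w * z))" if z: "z \<in> unit_disc" for z
  proof -
    have "norm (1 - cnj w * z) \<le> 1 + norm w * norm z"
      using norm_triangle_ineq4[of 1 "cnj w * z"] by (simp add: norm_mult)
    also have "\<dots> \<le> 2" using w z mult_le_one[of "norm w" "norm z"] by simp
    finally have "norm (1 - cnj w * z) \<le> 2" .
    then have "norm (z - w) * norm (1 - cnj w * z) \<le> norm (z - w) * 2"
      by (intro mult_left_mono) auto
    then have "norm (z - w) \<le> 2 * (norm (z - w) / norm (1 - cnj w * z))"
      using disc_denominator_ge(2)[OF w z] by (simp add: field_simps)
    then have "B * norm (z - w) \<le> B * (2 * (norm (z - w) / norm (1 - cnj w * z)))"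
      using B by (intro mult_left_mono)
    then show ?thesis using near[OF z] by (simp add: mult_ac)
  qed
  then show ?thesis by blast
qed

text \<open>At pseudo-hyperbolic distance \<open>\<rho>\<close> from \<open>w\<close> the kernel
  loses \<open>\<rho>\<close> squared, while the perturbation adds at most
  \<open>C * \<rho> * norm t\<close>. Hence the gain is only quadratic in \<open>t\<close>.\<close>

lemma disc_kernel_smooth:
  assumes w: "w \<in> unit_disc" and k: "k holomorphic_on unit_disc" "k w = 0"
    and M: "\<And>z. z \<in> unit_disc \<Longrightarrow> disc_weight z * norm (k z) \<le> M"
  shows "\<exists>C. \<forall>t. \<forall>z\<in>unit_disc. disc_weight z * norm (disc_kernel w z + t * k z) \<le> 1 + C * (norm t)\<^sup>2"
proof -
  obtain C where C: "\<And>z. z\<in>unit_disc \<Longrightarrow>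
      disc_weight z * norm (k z) \<le> C * (norm (z - w) / norm (1 - cnj w * z))"
    using weighted_bound_of_zero[OF assms] by blast
  have "disc_weight z * norm (disc_kernel w z + t * k z) \<le> 1 + C\<^sup>2 / 4 * (norm t)\<^sup>2"
    if z: "z \<in> unit_disc" for t z
  proof -
    define \<rho> where "\<rho> = norm (z - w) / norm (1 - cnj w * z)"
    have "disc_weight z * norm (disc_kernel w z + t * k z)
        \<le> disc_weight z * (norm (disc_kernel w z) + norm t * norm (k z))"
      using disc_weight_pos[OF z] norm_triangle_ineq[of "disc_kernel w z" "t * k z"]
      by (intro mult_left_mono) (auto simp: norm_mult)
    also have "\<dots> = 1 - \<rho>\<^sup>2 + norm t * (disc_weight z * norm (k z))"
      using disc_kernel_norm[OF w z] by (simp add: \<rho>_def algebra_simps)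
    also have "\<dots> \<le> 1 - \<rho>\<^sup>2 + norm t * (C * \<rho>)"
      using C[OF z] unfolding \<rho>_def by (intro add_left_mono mult_left_mono) auto
    \<comment> \<open>Completing the square in \<open>\<rho>\<close>.\<close>
    also have "\<dots> \<le> 1 + C\<^sup>2 / 4 * (norm t)\<^sup>2"
      using zero_le_power2[of "\<rho> - C * norm t / 2"] by (simp add: power2_eq_square algebra_simps)
    finally show ?thesis .
  qed
  then show ?thesis by blast
qed

text \<open>If \<open>l\<close> were nonzero, a small \<open>t\<close> turning \<open>t * l\<close>
  into the direction of \<open>c\<close> would increase the norm linearly, which a quadratic bound
  excludes.\<close>

lemma zero_if_quadratic_norm_bound:
  fixes c l :: complex
  assumes "norm c = 1" and bound: "\<And>t. norm (c + t * l) \<le> 1 + C * (norm t)\<^sup>2"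
  shows "l = 0"
proof (rule ccontr)
  assume "l \<noteq> 0"
  \<comment> \<open>Small enough for \<open>C * s < 1\<close>, whatever the sign of
    \<open>C\<close>.\<close>
  define s where "s = 1 / (\<bar>C\<bar> + 1)"
  have s: "0 < s" "C * s < 1" by (auto simp: s_def field_simps)
  define t where "t = of_real s * cnj l * c"
  have "c + t * l = of_real (1 + s * (norm l)\<^sup>2) * c"
    using complex_norm_square[of l] by (simp add: t_def algebra_simps)
  then have "norm (c + t * l) = 1 + s * (norm l)\<^sup>2"
    using s assms(1) by (simp add: norm_mult del: of_real_add)
  moreover have "(norm t)\<^sup>2 = s\<^sup>2 * (norm l)\<^sup>2"
    using s assms(1) by (simp add: t_def norm_mult power_mult_distrib)
  ultimately have "s * (norm l)\<^sup>2 \<le> C * s * (s * (norm l)\<^sup>2)"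
    using bound[of t] by (simp add: power2_eq_square mult_ac)
  moreover have "0 < s * (norm l)\<^sup>2" using s \<open>l \<noteq> 0\<close> by simp
  ultimately show False using mult_strict_right_mono[OF s(2)] by fastforce
qed

section \<open>Linear isometries and point evaluations\<close>

lemma complex_linear_on_lincomb:
  assumes "complex_linear_on little_zygmund_space_01 S"
    and "f \<in> little_zygmund_space_01" "g \<in> little_zygmund_space_01"
  shows "S (\<lambda>z. f z + c * g z) = (\<lambda>z. S f z + c * S g z)"
proof -
  have "S (\<lambda>z. f z + c * g z) = (\<lambda>z. S f z + S (\<lambda>z. c * g z) z)"
    using assms little_zygmund_01_cmult[OF assms(3), of c] unfolding complex_linear_on_def by simp
  moreover have "S (\<lambda>z. c * g z) = (\<lambda>z. c * S g z)"
    using assms unfolding complex_linear_on_def by blast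
  ultimately show ?thesis by simp
qed

lemma complex_linear_on_lincombI:
  assumes lc: "\<And>f g c. f \<in> little_zygmund_space_01 \<Longrightarrow> g \<in> little_zygmund_space_01 \<Longrightarrow>
      S (\<lambda>z. f z + c * g z) = (\<lambda>z. S f z + c * S g z)"
  shows "S (\<lambda>z. 0) = (\<lambda>z. 0)" "complex_linear_on little_zygmund_space_01 S"
proof -
  show S0: "S (\<lambda>z. 0) = (\<lambda>z. 0)"
    \<comment> \<open>Combining the zero function with itself by the factor -1 gives
      \<open>S 0 - S 0\<close>, hence zero.\<close>
    using lc[OF zero_in_little_zygmund_01 zero_in_little_zygmund_01, of "-1"] by simp
  show "complex_linear_on little_zygmund_space_01 S"
    unfolding complex_linear_on_def
  proof (intro conjI ballI allI)
    fix f g assume "f \<in> little_zygmund_space_01" "g \<in> little_zygmund_space_01"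
    then show "S (\<lambda>z. f z + g z) = (\<lambda>z. S f z + S g z)" using lc[of f g 1] by simp
  next
    fix a f assume "f \<in> little_zygmund_space_01"
    then show "S (\<lambda>z. a * f z) = (\<lambda>z. a * S f z)"
      using lc[OF zero_in_little_zygmund_01, of f a] S0 by simp
  qed
qed

text \<open>
  An isometry cannot destroy the differentiability of the norm at the kernel of \<open>w\<close>. At a point \<open>z\<close>
  where the image of the kernel attains its norm, the pulled-back evaluation is a support functional
  of the kernel, and by differentiability it is the evaluation at \<open>w\<close> up to a unimodular factor.
\<close>

lemma isometry_point_evaluation:
  assumes S: "S \<in> little_zygmund_space_01 \<rightarrow> little_zygmund_space_01"
    and lin: "complex_linear_on little_zygmund_space_01 S"
    and iso: "\<And>f. f \<in> little_zygmund_space_01 \<Longrightarrow> zygmund_norm (S f) = zygmund_norm f"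
    and w: "w \<in> unit_disc"
  shows "\<exists>z\<in>unit_disc. \<exists>l. norm l = 1 \<and> (\<forall>f\<in>little_zygmund_space_01.
      of_real (disc_weight w) * deriv (deriv f) w = l * of_real (disc_weight z) * deriv (deriv (S f)) z)"
proof -
  let ?V = little_zygmund_space_01
  obtain e where e: "e \<in> ?V" "\<And>z. z \<in> unit_disc \<Longrightarrow> deriv (deriv e) z = disc_kernel w z"
    using exists_disc_kernel[OF w] by blast
  have vw: "0 < disc_weight w" by (rule disc_weight_pos[OF w])
  have "zygmund_norm e = 1"
    unfolding zygmund_norm_01(3)[OF e(1)]
  proof (rule cSup_eq_maximum)
    show "1 \<in> (\<lambda>z. disc_weight z * norm (deriv (deriv e) z)) ` unit_disc"
      using w e(2) disc_kernel_norm[OF w w] by (intro image_eqI[of _ _ w]) auto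
  qed (use e(2) disc_kernel_norm[OF w] in auto)
  moreover obtain z where z: "z \<in> unit_disc" "disc_weight z * norm (deriv (deriv (S e)) z) = zygmund_norm (S e)"
    using zygmund_norm_01(2)[of "S e"] S e(1) by blast
  \<comment> \<open>The weighted value of the image of the kernel at a point where its norm is
    attained; it is unimodular because that norm is 1.\<close>
  define c where "c = of_real (disc_weight z) * deriv (deriv (S e)) z"
  ultimately have c: "norm c = 1"
    using iso[OF e(1)] z(2) disc_weight_pos[OF z(1)] by (simp add: norm_mult c_def)
  \<comment> \<open>The pulled-back evaluation kills every \<open>k\<close> whose second derivative
    vanishes at \<open>w\<close>, so it must be a multiple of the evaluation at
    \<open>w\<close>.\<close>
  have main: "of_real (disc_weight z) * deriv (deriv (S k)) z = 0"
    if k: "k \<in> ?V" "deriv (deriv k) w = 0" for k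
  proof -
    obtain C where C: "\<And>t x. x \<in> unit_disc \<Longrightarrow>
        disc_weight x * norm (disc_kernel w x + t * deriv (deriv k) x) \<le> 1 + C * (norm t)\<^sup>2"
      using disc_kernel_smooth[OF w little_zygmund_01_D(4)[OF k(1)] k(2) zygmund_norm_01(1)[OF k(1)]] by metis
    have "norm (c + t * (of_real (disc_weight z) * deriv (deriv (S k)) z)) \<le> 1 + C * (norm t)\<^sup>2" for t
    proof -
      define g where "g = (\<lambda>x. e x + t * k x)"
      have g: "g \<in> ?V" unfolding g_def by (rule little_zygmund_01_lincomb[OF e(1) k(1)])
      have Sek: "S e holomorphic_on unit_disc" "S k holomorphic_on unit_disc"
        using S e(1) k(1) little_zygmund_01_D(2) by blast+
      have "S g = (\<lambda>x. S e x + t * S k x)"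
        unfolding g_def by (rule complex_linear_on_lincomb[OF lin e(1) k(1)])
      then have "c + t * (of_real (disc_weight z) * deriv (deriv (S k)) z)
          = of_real (disc_weight z) * deriv (deriv (S g)) z"
        using deriv2_lincomb(2)[OF Sek z(1)] by (simp add: c_def algebra_simps)
      then have "norm (c + t * (of_real (disc_weight z) * deriv (deriv (S k)) z))
          = disc_weight z * norm (deriv (deriv (S g)) z)"
        using disc_weight_pos[OF z(1)] by (simp add: norm_mult)
      also have "\<dots> \<le> zygmund_norm (S g)"
        using zygmund_norm_01(1)[OF _ z(1)] S g by blast
      also have "\<dots> = zygmund_norm g" by (rule iso[OF g])
      also have "\<dots> \<le> 1 + C * (norm t)\<^sup>2"
        unfolding zygmund_norm_01(3)[OF g]
      proof (rule cSUP_least)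
        fix x assume x: "x \<in> unit_disc"
        have "deriv (deriv g) x = disc_kernel w x + t * deriv (deriv k) x"
          unfolding g_def using e(2)[OF x]
            deriv2_lincomb(2)[OF little_zygmund_01_D(2)[OF e(1)] little_zygmund_01_D(2)[OF k(1)] x] by simp
        then show "disc_weight x * norm (deriv (deriv g) x) \<le> 1 + C * (norm t)\<^sup>2"
          using C[OF x] by simp
      qed auto
      finally show ?thesis .
    qed
    then show ?thesis by (rule zero_if_quadratic_norm_bound[OF c])
  qed
  have "of_real (disc_weight w) * deriv (deriv f) w = cnj c * of_real (disc_weight z) * deriv (deriv (S f)) z"
    if f: "f \<in> ?V" for f
  proof -
    \<comment> \<open>The kernel at \<open>w\<close> equals the reciprocal of the weight, so adding
      \<open>a * e\<close> to \<open>f\<close> cancels the second derivative at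
      \<open>w\<close>.\<close>
    define a where "a = - (of_real (disc_weight w) * deriv (deriv f) w)"
    define k where "k = (\<lambda>x. f x + a * e x)"
    have "k \<in> ?V" unfolding k_def by (rule little_zygmund_01_lincomb[OF f e(1)])
    moreover have "deriv (deriv k) w = 0"
      unfolding k_def
      using deriv2_lincomb(2)[OF little_zygmund_01_D(2)[OF f] little_zygmund_01_D(2)[OF e(1)] w, of a]
        e(2)[OF w] disc_kernel_diag[OF w] vw by simp (simp add: a_def)
    ultimately have "of_real (disc_weight z) * deriv (deriv (S k)) z = 0" by (rule main)
    moreover have "S k = (\<lambda>x. S f x + a * S e x)"
      unfolding k_def by (rule complex_linear_on_lincomb[OF lin f e(1)])
    moreover have "S e holomorphic_on unit_disc" "S f holomorphic_on unit_disc"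
      using S e(1) f little_zygmund_01_D(2) by blast+
    ultimately have "of_real (disc_weight z) * deriv (deriv (S f)) z + a * c = 0"
      using deriv2_lincomb(2)[OF _ _ z(1), of "S f" "S e" a] by (simp add: c_def algebra_simps)
    then have eq: "of_real (disc_weight z) * deriv (deriv (S f)) z = c * (of_real (disc_weight w) * deriv (deriv f) w)"
      by (simp add: a_def algebra_simps)
    have "cnj c * c = 1" using c by (simp add: complex_norm_square[symmetric] mult.commute)
    then show ?thesis
      by (metis (no_types, lifting) eq mult.assoc mult_1)
  qed
  then show ?thesis using z(1) c by (intro bexI[of _ z] exI[of _ "cnj c"]) auto
qed

text \<open>Point evaluations are transported by \<open>S\<close> and then read at
  \<open>T f\<close>, where \<open>S (T f) = f\<close>. This gives the weighted composition
  pointwise; analyticity needs a separate argument.\<close>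

lemma isometry_weighted_composition:
  assumes T: "T \<in> little_zygmund_space_01 \<rightarrow> little_zygmund_space_01"
    and S: "S \<in> little_zygmund_space_01 \<rightarrow> little_zygmund_space_01"
    and lin: "complex_linear_on little_zygmund_space_01 S"
    and iso: "\<And>f. f \<in> little_zygmund_space_01 \<Longrightarrow> zygmund_norm (S f) = zygmund_norm f"
    and ST: "\<And>f. f \<in> little_zygmund_space_01 \<Longrightarrow> S (T f) = f"
  shows "\<exists>u \<sigma>. u holomorphic_on unit_disc \<and> \<sigma> holomorphic_on unit_disc \<and>
     (\<forall>w\<in>unit_disc. \<sigma> w \<in> unit_disc \<and> norm (u w) * disc_weight w = disc_weight (\<sigma> w)) \<and>
     (\<forall>f\<in>little_zygmund_space_01. \<forall>w\<in>unit_disc. deriv (deriv (T f)) w = u w * deriv (deriv f) (\<sigma> w))"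
proof -
  let ?V = little_zygmund_space_01
  have "\<exists>z l. z \<in> unit_disc \<and> norm l = 1 \<and> (\<forall>f\<in>?V.
      of_real (disc_weight w) * deriv (deriv (T f)) w = l * of_real (disc_weight z) * deriv (deriv f) z)"
    if w: "w \<in> unit_disc" for w
    using isometry_point_evaluation[OF S lin iso w] T ST by (metis (no_types, lifting) Pi_mem)
  then obtain \<tau> l where *: "\<And>w. w \<in> unit_disc \<Longrightarrow> \<tau> w \<in> unit_disc \<and> norm (l w) = 1 \<and> (\<forall>f\<in>?V.
      of_real (disc_weight w) * deriv (deriv (T f)) w = l w * of_real (disc_weight (\<tau> w)) * deriv (deriv f) (\<tau> w))"
    by metis
  define v where "v = (\<lambda>w. l w * of_real (disc_weight (\<tau> w)) / of_real (disc_weight w))"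
  have rep: "deriv (deriv (T f)) w = v w * deriv (deriv f) (\<tau> w)" if "f \<in> ?V" "w \<in> unit_disc" for f w
    using *[OF that(2)] that disc_weight_pos[OF that(2)] by (simp add: v_def field_simps)
  have nv: "norm (v w) * disc_weight w = disc_weight (\<tau> w)" if "w \<in> unit_disc" for w
    using *[OF that] disc_weight_pos[OF that] disc_weight_pos[of "\<tau> w"] by (simp add: v_def norm_mult norm_divide)
  obtain e0 where e0: "e0 \<in> ?V" "\<And>z. z \<in> unit_disc \<Longrightarrow> deriv (deriv e0) z = 1"
    using has_vanishing_second_primitive[of "\<lambda>_. 1"] bounded_imp_weight_vanishing[of "\<lambda>_. 1" 1] by auto
  obtain e1 where e1: "e1 \<in> ?V" "\<And>z. z \<in> unit_disc \<Longrightarrow> deriv (deriv e1) z = z"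
    using has_vanishing_second_primitive[of "\<lambda>z. z"] bounded_imp_weight_vanishing[of "\<lambda>z. z" 1] by force
  \<comment> \<open>The points \<open>\<tau> w\<close> and factors \<open>v w\<close> were merely
    chosen for each \<open>w\<close>. The images of the functions with second derivatives 1 and
    \<open>z\<close> recover them as holomorphic functions.\<close>
  define u where "u = deriv (deriv (T e0))"
  define \<sigma> where "\<sigma> = (\<lambda>z. deriv (deriv (T e1)) z / u z)"
  have uv: "u w = v w" if "w \<in> unit_disc" for w
    using rep[OF e0(1) that] e0(2) *[OF that] by (simp add: u_def)
  \<comment> \<open>The modulus of \<open>u w\<close> is a quotient of two positive weights, so the
    division defining \<open>\<sigma>\<close> is legitimate.\<close>
  have u0: "u w \<noteq> 0" if "w \<in> unit_disc" for w
    using uv[OF that] nv[OF that] *[OF that] disc_weight_pos[of "\<tau> w"] by auto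
  have st: "\<sigma> w = \<tau> w" if "w \<in> unit_disc" for w
    using rep[OF e1(1) that] e1(2) *[OF that] uv[OF that] u0[OF that] by (simp add: \<sigma>_def)
  have hu: "u holomorphic_on unit_disc"
    unfolding u_def by (rule little_zygmund_01_D(4)[OF Pi_mem[OF T e0(1)]])
  moreover have "\<sigma> holomorphic_on unit_disc"
    unfolding \<sigma>_def using u0
    by (intro holomorphic_on_divide hu little_zygmund_01_D(4)[OF Pi_mem[OF T e1(1)]])
  ultimately show ?thesis
    using rep nv * uv st by (intro exI[of _ u] exI[of _ \<sigma>]) auto
qed

subsection \<open>Disc automorphisms\<close>

lemma Moebius_has_field_derivative:
  assumes "w \<in> unit_disc" "z \<in> unit_disc"
  shows "(Moebius_function 0 w has_field_derivative disc_kernel w z) (at z)"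
proof -
  define d where "d = 1 - cnj w * z"
  have "d \<noteq> 0" using disc_denominator_ge(2)[OF assms] by (auto simp: d_def)
  have "((\<lambda>z. (z - w) / (1 - cnj w * z)) has_field_derivative
      (1 * (1 - cnj w * z) - (z - w) * (- cnj w)) / ((1 - cnj w * z) * (1 - cnj w * z))) (at z)"
    using \<open>d \<noteq> 0\<close> unfolding d_def
    by (intro DERIV_divide) (auto intro!: derivative_eq_intros)
  moreover have "1 * (1 - cnj w * z) - (z - w) * (- cnj w) = of_real (disc_weight w)"
    using complex_norm_square[of w] by (simp add: disc_weight_def algebra_simps)
  moreover have "Moebius_function 0 w = (\<lambda>z. (z - w) / (1 - cnj w * z))"
    by (simp add: fun_eq_iff Moebius_function_simple)
  ultimately show ?thesis
    by (simp add: disc_kernel_def power2_eq_square)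
qed

text \<open>Moebius maps move \<open>a\<close> and \<open>f a\<close> to the origin, where the
  Schwarz lemma bounds the derivative. Their derivatives contribute the weight at \<open>a\<close>
  and the reciprocal weight at \<open>f a\<close>.\<close>

lemma Schwarz_Pick:
  assumes f: "f holomorphic_on unit_disc" "f \<in> unit_disc \<rightarrow> unit_disc" and a: "a \<in> unit_disc"
  shows "norm (deriv f a) * disc_weight a \<le> disc_weight (f a)"
proof -
  define b where "b = f a"
  have b: "b \<in> unit_disc" using f(2) a by (auto simp: b_def)
  have ma: "- a \<in> unit_disc" using a by simp
  define F where "F = (\<lambda>z. Moebius_function 0 b (f (Moebius_function 0 (-a) z)))"
  have A: "Moebius_function 0 (-a) z \<in> unit_disc" if "norm z < 1" for z
    using Moebius_function_norm_lt_1[of "-a" z] a that by simp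
  have A0: "Moebius_function 0 (-a) 0 = a"
    by (simp add: Moebius_function_simple)
  have "F holomorphic_on unit_disc"
    unfolding F_def
    using holomorphic_on_compose_gen[OF holomorphic_on_compose_gen[OF Moebius_function_holomorphic f(1)]
        Moebius_function_holomorphic, of "-a" 0 b 0] a b A f(2)
    by (auto simp: o_def Pi_iff image_subset_iff)
  moreover have "F 0 = 0"
    by (simp add: F_def A0 Moebius_function_eq_zero flip: b_def)
  moreover have "norm (F z) < 1" if "norm z < 1" for z
    unfolding F_def using b funcset_mem[OF f(2) A[OF that]] by (intro Moebius_function_norm_lt_1) auto
  ultimately have "norm (deriv F 0) \<le> 1"
    using Schwarz_Lemma(2)[of F 0] by simp
  moreover have "(F has_field_derivative disc_kernel b b * (deriv f a * disc_kernel (-a) 0)) (at 0)"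
  proof -
    have "(Moebius_function 0 (-a) has_field_derivative disc_kernel (-a) 0) (at 0)"
      using Moebius_has_field_derivative[OF ma, of 0] by simp
    moreover have "(f has_field_derivative deriv f a) (at (Moebius_function 0 (-a) 0))"
      unfolding A0 using f(1) a by (intro holomorphic_derivI[OF _ open_ball])
    ultimately have "((\<lambda>z. f (Moebius_function 0 (-a) z)) has_field_derivative deriv f a * disc_kernel (-a) 0) (at 0)"
      by (rule DERIV_chain2[rotated])
    moreover have "(Moebius_function 0 b has_field_derivative disc_kernel b b) (at (f (Moebius_function 0 (-a) 0)))"
      unfolding A0 using Moebius_has_field_derivative[OF b b] by (simp flip: b_def)
    ultimately show ?thesis
      unfolding F_def by (rule DERIV_chain2[rotated])
  qed
  moreover have "disc_kernel (-a) 0 = of_real (disc_weight a)"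
    by (simp add: disc_kernel_def disc_weight_def)
  ultimately have "norm (1 / of_real (disc_weight b) * (deriv f a * of_real (disc_weight a))) \<le> 1"
    using disc_kernel_diag[OF b] by (simp add: DERIV_imp_deriv)
  then show ?thesis
    using disc_weight_pos[OF a] disc_weight_pos[OF b]
    by (simp add: norm_mult norm_divide pos_divide_le_eq flip: b_def)
qed

lemma disc_automorphism_inverse:
  assumes "disc_automorphism \<sigma>"
  obtains \<tau> where "\<tau> holomorphic_on unit_disc" "\<And>z. z \<in> unit_disc \<Longrightarrow> \<sigma> z \<in> unit_disc"
    "\<And>z. z \<in> unit_disc \<Longrightarrow> \<tau> z \<in> unit_disc" "\<And>z. z \<in> unit_disc \<Longrightarrow> \<tau> (\<sigma> z) = z"
    "\<And>z. z \<in> unit_disc \<Longrightarrow> \<sigma> (\<tau> z) = z"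
    "\<And>z. z \<in> unit_disc \<Longrightarrow> deriv \<sigma> z * deriv \<tau> (\<sigma> z) = 1"
    "\<And>z. z \<in> unit_disc \<Longrightarrow> norm (deriv \<sigma> z) * disc_weight z = disc_weight (\<sigma> z)"
proof -
  have hs: "\<sigma> holomorphic_on unit_disc" and bij: "inj_on \<sigma> unit_disc" "\<sigma> ` unit_disc = unit_disc"
    using assms by (auto simp: disc_automorphism_def analytic_on_open bij_betw_def)
  obtain \<tau> where t: "\<tau> holomorphic_on (\<sigma> ` unit_disc)"
    "\<And>z. z \<in> unit_disc \<Longrightarrow> deriv \<sigma> z * deriv \<tau> (\<sigma> z) = 1" "\<And>z. z \<in> unit_disc \<Longrightarrow> \<tau> (\<sigma> z) = z"
    using holomorphic_has_inverse[OF hs open_ball bij(1)] by metis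
  have sD: "\<sigma> z \<in> unit_disc" if "z \<in> unit_disc" for z
    using bij(2) that by blast
  have tD: "\<tau> z \<in> unit_disc \<and> \<sigma> (\<tau> z) = z" if "z \<in> unit_disc" for z
  proof -
    have "z \<in> \<sigma> ` unit_disc" using bij(2) that by simp
    then obtain x where "x \<in> unit_disc" "z = \<sigma> x" by blast
    then show ?thesis using t(3) by simp
  qed
  have ht: "\<tau> holomorphic_on unit_disc" using t(1) bij(2) by simp
  have eq: "norm (deriv \<sigma> z) * disc_weight z = disc_weight (\<sigma> z)" if z: "z \<in> unit_disc" for z
  proof (rule antisym)
    show "norm (deriv \<sigma> z) * disc_weight z \<le> disc_weight (\<sigma> z)"
      using Schwarz_Pick[OF hs _ z] sD by blast
    \<comment> \<open>Schwarz-Pick for the inverse map gives the reverse inequality, since the two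
      derivatives have product 1.\<close>
    have "norm (deriv \<sigma> z) * (norm (deriv \<tau> (\<sigma> z)) * disc_weight (\<sigma> z)) \<le> norm (deriv \<sigma> z) * disc_weight z"
      using Schwarz_Pick[OF ht _ sD[OF z]] tD t(3)[OF z] by (intro mult_left_mono) auto
    moreover have "norm (deriv \<sigma> z) * norm (deriv \<tau> (\<sigma> z)) = 1"
      using t(2)[OF z] by (metis norm_mult norm_one)
    ultimately show "disc_weight (\<sigma> z) \<le> norm (deriv \<sigma> z) * disc_weight z"
      by (metis mult.assoc mult_1)
  qed
  show thesis
    by (rule that[OF ht sD _ t(3) _ t(2) eq]) (use tD in auto)
qed

subsection \<open>Surjective isometries\<close>

lemma deriv_cong_disc:
  assumes "\<And>z. z \<in> unit_disc \<Longrightarrow> f z = g z" "z \<in> unit_disc"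
  shows "deriv f z = deriv g z"
proof (rule deriv_cong_ev)
  show "\<forall>\<^sub>F x in nhds z. f x = g x"
    using eventually_nhds_in_open[OF open_ball assms(2)] by eventually_elim (rule assms(1))
qed simp

text \<open>The integrand has a primitive \<open>F\<close> on the disc, so the formula says
  \<open>g = c * F\<close> for every path. Differentiating twice loses nothing: both sides and their
  first derivatives vanish at 0.\<close>

lemma integral_formula_iff_second_derivative:
  assumes f: "f \<in> little_zygmund_space_01" and g: "g \<in> little_zygmund_space_01"
    and s: "\<sigma> holomorphic_on unit_disc" "\<And>z. z \<in> unit_disc \<Longrightarrow> \<sigma> z \<in> unit_disc"
  shows "(\<forall>z\<in>unit_disc. \<forall>\<gamma>. valid_path \<gamma> \<and> path_image \<gamma> \<subseteq> unit_disc \<and>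
           pathstart \<gamma> = 0 \<and> pathfinish \<gamma> = z \<longrightarrow>
           g z = c * contour_integral \<gamma> (\<lambda>\<xi>. (deriv f \<circ> \<sigma>) \<xi> - (deriv f \<circ> \<sigma>) 0))
    \<longleftrightarrow> (\<forall>z\<in>unit_disc. deriv (deriv g) z = c * deriv \<sigma> z * deriv (deriv f) (\<sigma> z))"
proof -
  note fD = little_zygmund_01_D[OF f] and gD = little_zygmund_01_D[OF g]
  define k where "k = (\<lambda>\<xi>. (deriv f \<circ> \<sigma>) \<xi> - (deriv f \<circ> \<sigma>) 0)"
  have dk: "(k has_field_derivative deriv (deriv f) (\<sigma> z) * deriv \<sigma> z) (at z)" if "z \<in> unit_disc" for z
    unfolding k_def
    by (rule DERIV_diff[where E = 0, simplified], rule DERIV_chain)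
      (use that fD(3) s in \<open>auto intro: holomorphic_derivI[OF _ open_ball]\<close>)
  then have hk: "k holomorphic_on unit_disc"
    by (subst holomorphic_on_open) blast+
  obtain F0 where F0: "\<And>z. z \<in> unit_disc \<Longrightarrow> (F0 has_field_derivative k z) (at z within unit_disc)"
    using holomorphic_convex_primitive'[OF convex_ball open_ball hk] by metis
  define F where "F = (\<lambda>z. F0 z - F0 0)"
  have dF: "(F has_field_derivative k z) (at z)" if "z \<in> unit_disc" for z
    using F0[OF that] at_within_open[OF that open_ball] unfolding F_def
    by (auto intro!: derivative_eq_intros)
  then have hF: "F holomorphic_on unit_disc"
    by (subst holomorphic_on_open) blast+
  have int: "contour_integral \<gamma> k = F z"
    if "valid_path \<gamma>" "path_image \<gamma> \<subseteq> unit_disc" "pathstart \<gamma> = 0" "pathfinish \<gamma> = z" for \<gamma> z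
    using contour_integral_primitive[OF F0 that(1,2)] that(3,4)
    by (auto simp: F_def intro: contour_integral_unique)
  have "(\<forall>z\<in>unit_disc. \<forall>\<gamma>. valid_path \<gamma> \<and> path_image \<gamma> \<subseteq> unit_disc \<and>
           pathstart \<gamma> = 0 \<and> pathfinish \<gamma> = z \<longrightarrow> g z = c * contour_integral \<gamma> k)
     \<longleftrightarrow> (\<forall>z\<in>unit_disc. g z = c * F z)" (is "?A \<longleftrightarrow> ?B")
  proof
    assume A: ?A
    show ?B
    proof
      fix z assume z: "z \<in> unit_disc"
      \<comment> \<open>The straight segment is one admissible path, so the quantified formula is
        not vacuous at \<open>z\<close>.\<close>
      have "closed_segment 0 z \<subseteq> unit_disc"
        using z by (intro closed_segment_subset) auto
      then have "g z = c * contour_integral (linepath 0 z) k"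
        using A z by simp
      then show "g z = c * F z"
        using int[of "linepath 0 z" z] \<open>closed_segment 0 z \<subseteq> unit_disc\<close> by simp
    qed
  qed (auto simp: int)
  also have "?B \<longleftrightarrow> (\<forall>z\<in>unit_disc. deriv (deriv g) z = c * deriv \<sigma> z * deriv (deriv f) (\<sigma> z))" (is "_ \<longleftrightarrow> ?C")
  proof -
    have d1: "deriv (\<lambda>z. c * F z) z = c * k z" if "z \<in> unit_disc" for z
      using that by (intro DERIV_imp_deriv DERIV_cmult dF)
    have d2: "deriv (\<lambda>z. c * k z) z = c * deriv \<sigma> z * deriv (deriv f) (\<sigma> z)" if "z \<in> unit_disc" for z
      using DERIV_imp_deriv[OF DERIV_cmult[OF dk[OF that], of c]] by (simp add: mult_ac)
    show ?thesis
    proof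
      assume B: ?B
      then have "deriv g z = c * k z" if "z \<in> unit_disc" for z
        using deriv_cong_disc[of g "\<lambda>z. c * F z", OF _ that] d1[OF that] by simp
      then show ?C
        using deriv_cong_disc[of "deriv g" "\<lambda>z. c * k z"] d2 by simp
    next
      assume C: ?C
      have "deriv g z = c * k z" if "z \<in> unit_disc" for z
        by (rule holomorphic_unit_disc_eqI[OF gD(3) _ _ _ that])
          (use hk C d2 gD(7) in \<open>auto intro!: holomorphic_intros simp: k_def\<close>)
      then have "g z = c * F z" if "z \<in> unit_disc" for z
        by (intro holomorphic_unit_disc_eqI[OF gD(2) _ _ _ that])
          (use hF d1 gD(6) in \<open>auto intro!: holomorphic_intros simp: F_def\<close>)
      then show ?B by blast
    qed
  qed
  finally show ?thesis unfolding k_def .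
qed

text \<open>Since \<open>norm (deriv \<sigma> z)\<close> times the weight at \<open>z\<close> is the
  weight at \<open>\<sigma> z\<close>, the operator only permutes the values of the weighted
  modulus. Surjectivity comes from the analogous operator with the inverse automorphism.\<close>

lemma weighted_composition_isometry:
  assumes T: "T \<in> little_zygmund_space_01 \<rightarrow> little_zygmund_space_01"
    and s: "disc_automorphism \<sigma>" and c: "norm c = 1"
    and D: "\<And>f z. f \<in> little_zygmund_space_01 \<Longrightarrow> z \<in> unit_disc \<Longrightarrow>
        deriv (deriv (T f)) z = c * deriv \<sigma> z * deriv (deriv f) (\<sigma> z)"
  shows "complex_linear_on little_zygmund_space_01 T"
    and "zygmund_isometry_on little_zygmund_space_01 T"
    and "T ` little_zygmund_space_01 = little_zygmund_space_01"
proof -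
  let ?V = little_zygmund_space_01
  obtain \<tau> where t: "\<tau> holomorphic_on unit_disc" "\<And>z. z \<in> unit_disc \<Longrightarrow> \<sigma> z \<in> unit_disc"
    "\<And>z. z \<in> unit_disc \<Longrightarrow> \<tau> z \<in> unit_disc" "\<And>z. z \<in> unit_disc \<Longrightarrow> \<tau> (\<sigma> z) = z"
    "\<And>z. z \<in> unit_disc \<Longrightarrow> \<sigma> (\<tau> z) = z"
    "\<And>z. z \<in> unit_disc \<Longrightarrow> deriv \<sigma> z * deriv \<tau> (\<sigma> z) = 1"
    "\<And>z. z \<in> unit_disc \<Longrightarrow> norm (deriv \<sigma> z) * disc_weight z = disc_weight (\<sigma> z)"
    by (rule disc_automorphism_inverse[OF s]) (rule that)
  have TV: "T f \<in> ?V" if "f \<in> ?V" for f using T that by blast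
  note hol = little_zygmund_01_D(2)
  have lin: "T (\<lambda>z. f z + a * g z) = (\<lambda>z. T f z + a * T g z)" if f: "f \<in> ?V" and g: "g \<in> ?V" for f g a
  proof (rule little_zygmund_01_eqI)
    show "T (\<lambda>z. f z + a * g z) \<in> ?V" "(\<lambda>z. T f z + a * T g z) \<in> ?V"
      using f g by (auto intro!: TV little_zygmund_01_lincomb)
    fix z assume z: "z \<in> unit_disc"
    show "deriv (deriv (T (\<lambda>z. f z + a * g z))) z = deriv (deriv (\<lambda>z. T f z + a * T g z)) z"
      using D[OF little_zygmund_01_lincomb[OF f g] z, of a] D[OF f z] D[OF g z]
        deriv2_lincomb(2)[OF hol[OF f] hol[OF g] t(2)[OF z], of a]
        deriv2_lincomb(2)[OF hol[OF TV[OF f]] hol[OF TV[OF g]] z, of a]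
      by (simp add: algebra_simps)
  qed
  show "complex_linear_on ?V T" by (rule complex_linear_on_lincombI(2)[OF lin])
  have N: "zygmund_norm (T f) = zygmund_norm f" if f: "f \<in> ?V" for f
  proof -
    have "disc_weight z * norm (deriv (deriv (T f)) z) = disc_weight (\<sigma> z) * norm (deriv (deriv f) (\<sigma> z))"
      if "z \<in> unit_disc" for z
      using D[OF f that] c t(7)[OF that, symmetric] by (simp add: norm_mult)
    then have "(\<lambda>z. disc_weight z * norm (deriv (deriv (T f)) z)) ` unit_disc
        = (\<lambda>z. disc_weight z * norm (deriv (deriv f) z)) ` \<sigma> ` unit_disc"
      unfolding image_image by (intro image_cong) auto
    moreover have "\<sigma> ` unit_disc = unit_disc"
      using s by (simp add: disc_automorphism_def bij_betw_def)
    ultimately show ?thesis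
      by (simp add: zygmund_norm_01(3)[OF f] zygmund_norm_01(3)[OF TV[OF f]])
  qed
  show "zygmund_isometry_on ?V T"
    unfolding zygmund_isometry_on_def
  proof (intro ballI)
    fix f g assume fg: "f \<in> ?V" "g \<in> ?V"
    then show "zygmund_norm (\<lambda>z. T f z - T g z) = zygmund_norm (\<lambda>z. f z - g z)"
      using N[OF little_zygmund_01_lincomb[OF fg, of "-1"]] lin[OF fg, of "-1"] by simp
  qed
  have "\<exists>f\<in>?V. T f = g" if g: "g \<in> ?V" for g
  proof -
    note gD = little_zygmund_01_D[OF g]
    have c0: "c \<noteq> 0" using c by auto
    have hs: "\<sigma> holomorphic_on unit_disc" using s by (simp add: disc_automorphism_def analytic_on_open)
    \<comment> \<open>The second derivative that the preimage of \<open>g\<close> must have, found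
      by solving the composition formula with \<open>\<tau>\<close>.\<close>
    define h where "h = (\<lambda>z. deriv \<tau> z * deriv (deriv g) (\<tau> z) / c)"
    have "(deriv (deriv g) \<circ> \<tau>) holomorphic_on unit_disc"
      using t(1,3) gD(4) by (intro holomorphic_on_compose_gen) auto
    then have "h holomorphic_on unit_disc"
      unfolding h_def o_def using t(1) c0 by (intro holomorphic_intros) auto
    moreover have "weight_vanishing h"
      unfolding weight_vanishing_iff_compact
    proof (intro allI impI)
      fix e :: real assume "e > 0"
      from gD(5)[unfolded weight_vanishing_iff_compact, THEN spec, THEN mp, OF this]
      obtain K where K: "compact K" "K \<subseteq> unit_disc"
        "\<And>z. z\<in>unit_disc - K \<Longrightarrow> disc_weight z * norm (deriv (deriv g) z) < e"
        by blast
      \<comment> \<open>Outside the image of \<open>K\<close>, \<open>\<tau>\<close> lands outside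
        \<open>K\<close>; there the weighted modulus of \<open>h\<close> equals that of
        \<open>deriv (deriv g)\<close> at \<open>\<tau> z\<close>.\<close>
      have "compact (\<sigma> ` K)"
        using K hs by (intro compact_continuous_image continuous_on_subset[OF holomorphic_on_imp_continuous_on]) auto
      moreover have "\<sigma> ` K \<subseteq> unit_disc" using t(2) K(2) by blast
      moreover have "disc_weight z * norm (h z) < e" if z: "z \<in> unit_disc - \<sigma> ` K" for z
      proof -
        have zD: "z \<in> unit_disc" using z by blast
        have "\<tau> z \<in> unit_disc - K" using z t(3,5)[OF zD] by (metis Diff_iff image_eqI)
        then have "disc_weight (\<tau> z) * norm (deriv (deriv g) (\<tau> z)) < e" by (rule K(3))
        moreover have "disc_weight (\<tau> z) = norm (deriv \<tau> z) * disc_weight z"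
        proof -
          have "norm (deriv \<sigma> (\<tau> z)) * norm (deriv \<tau> z) = 1"
            using t(6)[OF t(3)[OF zD]] t(5)[OF zD] by (metis norm_mult norm_one)
          then show ?thesis
            using t(7)[OF t(3)[OF zD]] t(5)[OF zD] by (metis mult.assoc mult.commute mult_1)
        qed
        ultimately show ?thesis
          using c by (simp add: h_def norm_mult norm_divide mult_ac)
      qed
      ultimately show "\<exists>K. compact K \<and> K \<subseteq> unit_disc \<and> (\<forall>z\<in>unit_disc - K. disc_weight z * norm (h z) < e)"
        by blast
    qed
    ultimately obtain f where f: "f \<in> ?V" "\<And>z. z \<in> unit_disc \<Longrightarrow> deriv (deriv f) z = h z"
      using has_vanishing_second_primitive by blast
    have "T f = g"
    proof (rule little_zygmund_01_eqI[OF TV[OF f(1)] g])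
      fix z assume z: "z \<in> unit_disc"
      have "deriv (deriv (T f)) z = (deriv \<sigma> z * deriv \<tau> (\<sigma> z)) * deriv (deriv g) z"
        using D[OF f(1) z] f(2)[OF t(2)[OF z]] t(4)[OF z] c0 by (simp add: h_def)
      then show "deriv (deriv (T f)) z = deriv (deriv g) z" using t(6)[OF z] by simp
    qed
    then show ?thesis using f(1) by blast
  qed
  then show "T ` ?V = ?V" using TV by blast
qed

section \<open>The constant phase and the form of every surjective isometry\<close>

lemma holomorphic_eq_unimodular_multiple:
  assumes "u holomorphic_on unit_disc" "s holomorphic_on unit_disc"
    and "\<And>z. z \<in> unit_disc \<Longrightarrow> norm (u z) = norm (s z)" "\<And>z. z \<in> unit_disc \<Longrightarrow> s z \<noteq> 0"
  shows "\<exists>\<alpha>::real. \<forall>z\<in>unit_disc. u z = exp (\<i> * of_real \<alpha>) * s z"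
proof -
  have n: "norm (u z / s z) = 1" if "z \<in> unit_disc" for z
    using assms(3,4)[OF that] by (simp add: norm_divide)
  \<comment> \<open>The modulus is identically 1, so its maximum is attained at the interior point
    0.\<close>
  have "(\<lambda>z. u z / s z) constant_on unit_disc"
    by (rule maximum_modulus_principle[where U = unit_disc and \<xi> = 0])
      (use assms n in \<open>auto intro!: holomorphic_intros simp del: norm_divide\<close>)
  then obtain c where c: "\<And>z. z \<in> unit_disc \<Longrightarrow> u z / s z = c"
    unfolding constant_on_def by blast
  have "norm c = 1" using n[of 0] c[of 0] by simp
  then have "c \<noteq> 0" by auto
  from Arg_eq[OF this] have "c = exp (\<i> * of_real (Arg c))"
    unfolding \<open>norm c = 1\<close> by simp
  then show ?thesis using c assms(4) by (metis nonzero_eq_divide_eq)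
qed

lemma isometry_is_weighted_composition:
  assumes T: "T \<in> little_zygmund_space_01 \<rightarrow> little_zygmund_space_01"
    and lin: "complex_linear_on little_zygmund_space_01 T"
    and iso: "zygmund_isometry_on little_zygmund_space_01 T"
    and surj: "T ` little_zygmund_space_01 = little_zygmund_space_01"
  shows "\<exists>\<sigma>. \<exists>\<alpha>::real. disc_automorphism \<sigma> \<and>
    (\<forall>f\<in>little_zygmund_space_01. \<forall>z\<in>unit_disc.
        deriv (deriv (T f)) z = exp (\<i> * of_real \<alpha>) * deriv \<sigma> z * deriv (deriv f) (\<sigma> z))"
proof -
  let ?V = little_zygmund_space_01
  have TV: "T f \<in> ?V" if "f \<in> ?V" for f using T that by blast
  have lc: "T (\<lambda>z. f z + c * g z) = (\<lambda>z. T f z + c * T g z)" if "f \<in> ?V" "g \<in> ?V" for f g c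
    by (rule complex_linear_on_lincomb[OF lin that])
  have T0: "T (\<lambda>z. 0) = (\<lambda>z. 0)" by (rule complex_linear_on_lincombI(1)[OF lc])
  \<comment> \<open>Comparison with the zero function turns preservation of distances into
    preservation of norms.\<close>
  have N: "zygmund_norm (T f) = zygmund_norm f" if "f \<in> ?V" for f
    using iso that zero_in_little_zygmund_01 T0 unfolding zygmund_isometry_on_def
    by (metis (no_types, lifting) diff_zero ext)
  have "inj_on T ?V"
  proof (rule inj_onI)
    fix f g assume fg: "f \<in> ?V" "g \<in> ?V" "T f = T g"
    define h where "h = (\<lambda>z. f z + (-1) * g z)"
    have h: "h \<in> ?V" unfolding h_def by (rule little_zygmund_01_lincomb[OF fg(1,2)])
    have "T h = T (\<lambda>z. 0)"
      unfolding h_def using lc[OF fg(1,2), of "-1"] fg(3) T0 by simp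
    then have "zygmund_norm h = zygmund_norm (\<lambda>z. 0)"
      using N[OF h] N[OF zero_in_little_zygmund_01] by simp
    also have "\<dots> = 0"
      using zygmund_norm_01(2)[OF zero_in_little_zygmund_01] by auto
    finally have "deriv (deriv h) z = 0" if "z \<in> unit_disc" for z
      using zygmund_norm_01(1)[OF h that] disc_weight_pos[OF that] by (simp add: mult_le_0_iff)
    then have "deriv (deriv f) z = deriv (deriv g) z" if "z \<in> unit_disc" for z
      using deriv2_lincomb(2)[OF little_zygmund_01_D(2)[OF fg(1)] little_zygmund_01_D(2)[OF fg(2)] that, of "-1"] that
      unfolding h_def by simp
    then show "f = g" by (rule little_zygmund_01_eqI[OF fg(1,2)])
  qed
  define S where "S = inv_into ?V T"
  have SV: "S f \<in> ?V" and TS: "T (S f) = f" if "f \<in> ?V" for f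
    using that surj unfolding S_def by (metis inv_into_into, metis f_inv_into_f)
  have ST: "S (T f) = f" if "f \<in> ?V" for f
    unfolding S_def by (rule inv_into_f_f[OF \<open>inj_on T ?V\<close> that])
  have SP: "S \<in> ?V \<rightarrow> ?V" using SV by blast
  have NS: "zygmund_norm (S f) = zygmund_norm f" if "f \<in> ?V" for f
    using N[OF SV[OF that]] TS[OF that] by simp
  have lcS: "S (\<lambda>z. f z + c * g z) = (\<lambda>z. S f z + c * S g z)" if "f \<in> ?V" "g \<in> ?V" for f g c
    using lc[OF SV[OF that(1)] SV[OF that(2)], of c] TS[OF that(1)] TS[OF that(2)]
      ST[OF little_zygmund_01_lincomb[OF SV[OF that(1)] SV[OF that(2)]], of c] by simp
  have linS: "complex_linear_on ?V S" by (rule complex_linear_on_lincombI(2)[OF lcS])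
  obtain u \<sigma> where u: "u holomorphic_on unit_disc" "\<sigma> holomorphic_on unit_disc"
    "\<And>w. w \<in> unit_disc \<Longrightarrow> \<sigma> w \<in> unit_disc"
    "\<And>w. w \<in> unit_disc \<Longrightarrow> norm (u w) * disc_weight w = disc_weight (\<sigma> w)"
    "\<And>f w. f \<in> ?V \<Longrightarrow> w \<in> unit_disc \<Longrightarrow> deriv (deriv (T f)) w = u w * deriv (deriv f) (\<sigma> w)"
    using isometry_weighted_composition[OF T SP linS NS ST] by blast
  \<comment> \<open>The same representation for the inverse \<open>S\<close>, with the roles of
    \<open>T\<close> and \<open>S\<close> exchanged.\<close>
  obtain v \<tau> where v: "v holomorphic_on unit_disc" "\<tau> holomorphic_on unit_disc"
    "\<And>w. w \<in> unit_disc \<Longrightarrow> \<tau> w \<in> unit_disc"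
    "\<And>w. w \<in> unit_disc \<Longrightarrow> norm (v w) * disc_weight w = disc_weight (\<tau> w)"
    "\<And>f w. f \<in> ?V \<Longrightarrow> w \<in> unit_disc \<Longrightarrow> deriv (deriv (S f)) w = v w * deriv (deriv f) (\<tau> w)"
    using isometry_weighted_composition[OF SP T lin N TS] by blast
  obtain e0 where e0: "e0 \<in> ?V" "\<And>z. z \<in> unit_disc \<Longrightarrow> deriv (deriv e0) z = 1"
    using has_vanishing_second_primitive[of "\<lambda>_. 1"] bounded_imp_weight_vanishing[of "\<lambda>_. 1" 1] by auto
  obtain e1 where e1: "e1 \<in> ?V" "\<And>z. z \<in> unit_disc \<Longrightarrow> deriv (deriv e1) z = z"
    using has_vanishing_second_primitive[of "\<lambda>z. z"] bounded_imp_weight_vanishing[of "\<lambda>z. z" 1] by force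
  \<comment> \<open>Applying \<open>T (S f) = f\<close> to second derivative 1 gives
    \<open>u w * v (\<sigma> w) = 1\<close>; second derivative \<open>z\<close> then gives
    \<open>w = \<tau> (\<sigma> w)\<close>.\<close>
  have ts: "\<tau> (\<sigma> w) = w" if w: "w \<in> unit_disc" for w
  proof -
    note w' = u(3)[OF w] and w'' = v(3)[OF u(3)[OF w]]
    have "u w * v (\<sigma> w) = 1"
      using u(5)[OF SV[OF e0(1)] w] v(5)[OF e0(1) w'] TS[OF e0(1)] e0(2)[OF w] e0(2)[OF w''] by simp
    moreover have "w = u w * (v (\<sigma> w) * \<tau> (\<sigma> w))"
      using u(5)[OF SV[OF e1(1)] w] unfolding TS[OF e1(1)] v(5)[OF e1(1) w'] e1(2)[OF w] e1(2)[OF w''] .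
    ultimately show ?thesis by (metis mult.assoc mult_1)
  qed
  have st: "\<sigma> (\<tau> w) = w" if w: "w \<in> unit_disc" for w
  proof -
    note w' = v(3)[OF w] and w'' = u(3)[OF v(3)[OF w]]
    have "v w * u (\<tau> w) = 1"
      using v(5)[OF TV[OF e0(1)] w] u(5)[OF e0(1) w'] ST[OF e0(1)] e0(2)[OF w] e0(2)[OF w''] by simp
    moreover have "w = v w * (u (\<tau> w) * \<sigma> (\<tau> w))"
      using v(5)[OF TV[OF e1(1)] w] unfolding ST[OF e1(1)] u(5)[OF e1(1) w'] e1(2)[OF w] e1(2)[OF w''] .
    ultimately show ?thesis by (metis mult.assoc mult_1)
  qed
  have "bij_betw \<sigma> unit_disc unit_disc"
    by (rule bij_betw_byWitness[where f' = \<tau>]) (use ts st u(3) v(3) in blast)+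
  then have aut: "disc_automorphism \<sigma>"
    unfolding disc_automorphism_def analytic_on_open[OF open_ball] using u(2) by blast
  have ds: "norm (deriv \<sigma> z) * disc_weight z = disc_weight (\<sigma> z)" if "z \<in> unit_disc" for z
    by (rule disc_automorphism_inverse[OF aut]) (use that in blast)
  \<comment> \<open>Both moduli equal the weight at \<open>\<sigma> z\<close> divided by the weight
    at \<open>z\<close>.\<close>
  have "norm (u z) = norm (deriv \<sigma> z)" if "z \<in> unit_disc" for z
    using ds[OF that] u(4)[OF that] disc_weight_pos[OF that] by (metis less_irrefl mult_right_cancel)
  moreover have "deriv \<sigma> z \<noteq> 0" if "z \<in> unit_disc" for z
    using ds[OF that] disc_weight_pos[OF u(3)[OF that]] by auto
  ultimately obtain \<alpha> :: real where "\<forall>z\<in>unit_disc. u z = exp (\<i> * of_real \<alpha>) * deriv \<sigma> z"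
    using holomorphic_eq_unimodular_multiple[OF u(1) holomorphic_deriv[OF u(2) open_ball]] by blast
  then have "\<forall>f\<in>?V. \<forall>z\<in>unit_disc.
      deriv (deriv (T f)) z = exp (\<i> * of_real \<alpha>) * deriv \<sigma> z * deriv (deriv f) (\<sigma> z)"
    using u(5) by simp
  then show ?thesis using aut by blast
qed

theorem theorem3p2:
  fixes T :: "(complex \<Rightarrow> complex) \<Rightarrow> (complex \<Rightarrow> complex)"
  assumes "T \<in> little_zygmund_space_01 \<rightarrow> little_zygmund_space_01"
  shows "(complex_linear_on little_zygmund_space_01 T
          \<and> zygmund_isometry_on little_zygmund_space_01 T
          \<and> T ` little_zygmund_space_01 = little_zygmund_space_01)
     \<longleftrightarrow>
     (\<exists>\<sigma>. \<exists>\<alpha>::real. disc_automorphism \<sigma> \<and>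
        (\<forall>f\<in>little_zygmund_space_01. \<forall>z\<in>unit_disc. \<forall>\<gamma>.
           valid_path \<gamma> \<and> path_image \<gamma> \<subseteq> unit_disc \<and> pathstart \<gamma> = 0 \<and> pathfinish \<gamma> = z \<longrightarrow>
           T f z = exp (\<i> * of_real \<alpha>) *
             contour_integral \<gamma> (\<lambda>\<xi>. (deriv f \<circ> \<sigma>) \<xi> - (deriv f \<circ> \<sigma>) 0)))"
  (is "?L \<longleftrightarrow> (\<exists>\<sigma>. \<exists>\<alpha>. _ \<sigma> \<and> ?R \<sigma> \<alpha>)")
proof -
  \<comment> \<open>For a fixed automorphism the integral formula is replaced by its
    second-derivative form, in which both implications have been established.\<close>
  have R: "?R \<sigma> \<alpha> \<longleftrightarrow> (\<forall>f\<in>little_zygmund_space_01. \<forall>z\<in>unit_disc.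
        deriv (deriv (T f)) z = exp (\<i> * of_real \<alpha>) * deriv \<sigma> z * deriv (deriv f) (\<sigma> z))"
    if "disc_automorphism \<sigma>" for \<sigma> and \<alpha> :: real
  proof (rule ball_cong[OF refl])
    fix f assume f: "f \<in> little_zygmund_space_01"
    have "\<sigma> holomorphic_on unit_disc" "\<And>z. z \<in> unit_disc \<Longrightarrow> \<sigma> z \<in> unit_disc"
      using that by (auto simp: disc_automorphism_def analytic_on_open bij_betw_def)
    then show "(\<forall>z\<in>unit_disc. \<forall>\<gamma>.
           valid_path \<gamma> \<and> path_image \<gamma> \<subseteq> unit_disc \<and> pathstart \<gamma> = 0 \<and> pathfinish \<gamma> = z \<longrightarrow>
           T f z = exp (\<i> * of_real \<alpha>) *
             contour_integral \<gamma> (\<lambda>\<xi>. (deriv f \<circ> \<sigma>) \<xi> - (deriv f \<circ> \<sigma>) 0)) \<longleftrightarrow>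
        (\<forall>z\<in>unit_disc. deriv (deriv (T f)) z = exp (\<i> * of_real \<alpha>) * deriv \<sigma> z * deriv (deriv f) (\<sigma> z))"
      by (rule integral_formula_iff_second_derivative[OF f Pi_mem[OF assms f]])
  qed
  show ?thesis
  proof
    assume L: ?L
    obtain \<sigma> and \<alpha> :: real where s: "disc_automorphism \<sigma>" and
      D: "\<forall>f\<in>little_zygmund_space_01. \<forall>z\<in>unit_disc.
        deriv (deriv (T f)) z = exp (\<i> * of_real \<alpha>) * deriv \<sigma> z * deriv (deriv f) (\<sigma> z)"
      using isometry_is_weighted_composition[OF assms L[THEN conjunct1]
          L[THEN conjunct2, THEN conjunct1] L[THEN conjunct2, THEN conjunct2]] by (elim exE conjE)
    have "?R \<sigma> \<alpha>" by (rule R[OF s, THEN iffD2, OF D])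
    with s show "\<exists>\<sigma>. \<exists>\<alpha>. disc_automorphism \<sigma> \<and> ?R \<sigma> \<alpha>" by (intro exI conjI)
  next
    assume "\<exists>\<sigma>. \<exists>\<alpha>. disc_automorphism \<sigma> \<and> ?R \<sigma> \<alpha>"
    then obtain \<sigma> \<alpha> where s: "disc_automorphism \<sigma>" and "?R \<sigma> \<alpha>" by (elim exE conjE)
    note D = R[OF s, THEN iffD1, OF this(2), THEN bspec, THEN bspec]
    have "norm (exp (\<i> * of_real \<alpha>)) = 1" by simp
    from weighted_composition_isometry[OF assms s this D] show ?L by (intro conjI)
  qed
qed

end
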